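(* Let $\xi<\omega_1$ and let $(e_n)_{n\in\mathbb N}$ be a basis of a Banach space $X$ such that for every infinite $L\subset\mathbb N$ the subsequence $(e_n)_{n\in L}$ admits an $\ell_1$-tree $\mathcal T_L\subset\{(e_n)_{n\in F}: F\subset L,\ F\text{ finite}\}$ of order $\omega^{\xi}$. Then some subsequence of $(e_n)_{n\in\mathbb N}$ generates an $\ell_1^{\xi}$-spreading model.
   Context: Trees. A tree on a set $X$ is a set $\mathcal{T}\subset\bigcup_{n\ge 1}X^n$ such that $(x_1,\dots,x_k)\in\mathcal{T}$ whenever $(x_1,\dots,x_{k+1})\in\mathcal{T}$, $k\ge1$. Put $D(\mathcal{T})=\{(x_1,\dots,x_k): (x_1,\dots,x_k,x)\in\mathcal{T}\text{ for some }x\in X\}$, $D^0(\mathcal T)=\mathcal T$, $D^{\alpha+1}(\mathcal T)=D(D^\alpha(\mathcal T))$, $D^\alpha(\mathcal T)=\bigcap_{\beta<\alpha}D^\beta(\mathcal T)$ for limit $\alpha$. The order of a well-founded tree is $o(\mathcal T)=\inf\{\alpha: D^\alpha(\mathcal T)=\emptyset\}$. An $\ell_1$-tree on a Banach space $X$ with constant $C\ge1$ is a tree on $X$ each of whose elements $(x_1,\dots,x_k)$ is a normalized sequence $C$-equivalent to the unit vector basis of $\ell_1^k$; an $\ell_1$-tree is an $\ell_1$-tree with some constant $C\ge1$ (here the constant may depend on $L$). For a finite set $F=\{n_1<\dots<n_k\}$, $(e_n)_{n\in F}$ denotes $(e_{n_1},\dots,e_{n_k})$. Schreier families. $\mathcal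 S_0=\{\{n\}:n\in\mathbb N\}\cup\{\emptyset\}$; $\mathcal S_{\xi+1}=\{F_1\cup\dots\cup F_m: m\in\mathbb N,\ F_1,\dots,F_m\in\mathcal S_\xi,\ m\le F_1<\dots<F_m\}$; for a limit ordinal $\xi<\omega_1$ one fixes a sequence $\xi_n\nearrow\xi$ and sets $\mathcal S_\xi=\{F: F\in\mathcal S_{\xi_n}\text{ and }n\le F\text{ for some }n\in\mathbb N\}$. (For sets, $F<G$ means $\max F<\min G$, and $m\le F$ means $m\le\min F$.) A normalized basic sequence $(x_i)_{i\in\mathbb N}$ generates an $\ell_1^\xi$-spreading model if there is $C\ge1$ such that for every $F\in\mathcal S_\xi$ the sequence $(x_i)_{i\in F}$ is $C$-equivalent to the unit vector basis of $\ell_1^{\#F}$. *)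

theory Defs
  imports "HOL-Analysis.Analysis" "HOL-Library.Countable_Set_Type"
begin

section \<open>Countable ordinals\<close>

text \<open>
  The ordinals below \<open>\<omega>\<^sub>1\<close> are the elements of the successor cardinal of \<open>\<aleph>\<^sub>0\<close>,
  which is an initial well-order of type \<open>\<omega>\<^sub>1\<close>.
\<close>

typedef cord = "Field (cardSuc natLeq)"
  using Field_cardSuc_not_empty[OF natLeq_Card_order] by blast

instantiation cord :: wellorder
begin

definition less_eq_cord :: "cord \<Rightarrow> cord \<Rightarrow> bool" where
  "\<alpha> \<le> \<beta> \<longleftrightarrow> (Rep_cord \<alpha>, Rep_cord \<beta>) \<in> cardSuc natLeq"

definition less_cord :: "cord \<Rightarrow> cord \<Rightarrow> bool" where
  "\<alpha> < \<beta> \<longleftrightarrow> \<alpha> \<le> \<beta> \<and> \<alpha> \<noteq> (\<beta> :: cord)"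

instance
proof -
  have W: "Well_order (cardSuc natLeq)"
    by (rule cardSuc_Well_order[OF natLeq_Card_order])
  have refl: "\<alpha> \<le> \<alpha>" for \<alpha> :: cord
    using W Rep_cord[of \<alpha>] unfolding less_eq_cord_def order_on_defs refl_on_def by blast
  have antisym: "\<alpha> = \<beta>" if "\<alpha> \<le> \<beta>" "\<beta> \<le> \<alpha>" for \<alpha> \<beta> :: cord
    using W that unfolding less_eq_cord_def order_on_defs antisym_def
    by (metis Rep_cord_inject)
  have trans: "\<alpha> \<le> \<gamma>" if "\<alpha> \<le> \<beta>" "\<beta> \<le> \<gamma>" for \<alpha> \<beta> \<gamma> :: cord
    using W that unfolding less_eq_cord_def order_on_defs trans_def by blast
  have total: "\<alpha> \<le> \<beta> \<or> \<beta> \<le> \<alpha>" for \<alpha> \<beta> :: cord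
    using W Rep_cord[of \<alpha>] Rep_cord[of \<beta>] refl
    unfolding less_eq_cord_def order_on_defs total_on_def by (metis Rep_cord_inject)
  have wf: "wf {(\<alpha>, \<beta>). \<alpha> < (\<beta> :: cord)}"
  proof (rule wf_subset)
    show "wf (inv_image (cardSuc natLeq - Id) Rep_cord)"
      using W unfolding well_order_on_def by (intro wf_inv_image) blast
    show "{(\<alpha>, \<beta>). \<alpha> < (\<beta> :: cord)} \<subseteq> inv_image (cardSuc natLeq - Id) Rep_cord"
      by (auto simp: less_cord_def less_eq_cord_def Rep_cord_inject)
  qed
  show "OFCLASS(cord, wellorder_class)"
  proof
    fix P :: "cord \<Rightarrow> bool" and \<alpha> :: cord
    assume *: "\<And>\<alpha>. (\<And>\<beta>. \<beta> < \<alpha> \<Longrightarrow> P \<beta>) \<Longrightarrow> P \<alpha>"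
    show "P \<alpha>" by (rule wf_induct_rule[OF wf]) (use * in auto)
  qed (use refl antisym trans total in \<open>auto simp: less_cord_def\<close>)
qed

end

lemma countable_lessThan_cord: "countable {..<(\<alpha> :: cord)}"
proof -
  include cardinal_syntax
  let ?r = "cardSuc natLeq"
  have "|underS ?r (Rep_cord \<alpha>)| <o ?r"
    by (rule card_of_underS[OF cardSuc_Card_order[OF natLeq_Card_order] Rep_cord])
  hence "|underS ?r (Rep_cord \<alpha>)| \<le>o natLeq"
    using cardSuc_ordLess_ordLeq[OF natLeq_Card_order card_of_Card_order]
    by (metis cardSuc_ordLeq_ordLess card_of_Card_order natLeq_Card_order)
  hence "countable (underS ?r (Rep_cord \<alpha>))"
    by (simp add: countable_card_le_natLeq)
  moreover have "Rep_cord ` {..<\<alpha>} \<subseteq> underS ?r (Rep_cord \<alpha>)"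
    by (auto simp: underS_def less_cord_def less_eq_cord_def Rep_cord_inject)
  ultimately show ?thesis
    by (metis Rep_cord_inject countable_subset countable_image_inj_on inj_onI)
qed

lemma uncountable_UNIV_cord: "uncountable (UNIV :: cord set)"
proof
  include cardinal_syntax
  assume "countable (UNIV :: cord set)"
  hence "countable (range Rep_cord)" by simp
  hence "countable (Field (cardSuc natLeq))"
    by (simp add: type_definition.Rep_range[OF type_definition_cord])
  hence "|Field (cardSuc natLeq)| \<le>o natLeq" by (simp add: countable_card_le_natLeq)
  moreover have "|Field (cardSuc natLeq)| =o cardSuc natLeq"
    by (rule card_of_Field_ordIso[OF cardSuc_Card_order[OF natLeq_Card_order]])
  ultimately have "cardSuc natLeq \<le>o natLeq"
    using ordIso_ordLeq_trans ordIso_symmetric by blast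
  thus False
    using cardSuc_greater[OF natLeq_Card_order] not_ordLess_ordLeq by blast
qed

lemma countable_bounded_cord:
  assumes "countable (A :: cord set)"
  shows "\<exists>\<beta>. \<forall>\<alpha>\<in>A. \<alpha> < \<beta>"
proof (rule ccontr)
  assume "\<not> ?thesis"
  hence "UNIV = (\<Union>\<alpha>\<in>A. insert \<alpha> {..<\<alpha>})"
    by (auto simp: not_less) (metis order_le_less)
  moreover have "countable (\<Union>\<alpha>\<in>A. insert \<alpha> {..<\<alpha>})"
    using assms countable_lessThan_cord by auto
  ultimately show False using uncountable_UNIV_cord by simp
qed

definition succ :: "cord \<Rightarrow> cord" where
  "succ \<alpha> = (LEAST \<beta>. \<alpha> < \<beta>)"

definition osup :: "cord set \<Rightarrow> cord" where
  "osup A = (LEAST \<beta>. \<forall>\<alpha>\<in>A. \<alpha> \<le> \<beta>)"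

instantiation cord :: "{zero, one}"
begin
definition zero_cord :: cord where "0 = (LEAST \<alpha> :: cord. True)"
definition one_cord :: cord where "1 = succ 0"
instance ..
end

definition is_limit :: "cord \<Rightarrow> bool" where
  "is_limit \<alpha> \<longleftrightarrow> \<alpha> \<noteq> 0 \<and> (\<nexists>\<beta>. \<alpha> = succ \<beta>)"

lemma zero_le_cord: "0 \<le> (\<alpha> :: cord)"
  unfolding zero_cord_def by (simp add: Least_le)

lemma less_succ: "\<alpha> < succ \<alpha>"
  unfolding succ_def using countable_bounded_cord[of "{\<alpha>}"] by (auto intro: LeastI)

lemma less_succ_iff: "\<beta> < succ \<alpha> \<longleftrightarrow> \<beta> \<le> \<alpha>"
proof
  show "\<beta> \<le> \<alpha>" if "\<beta> < succ \<alpha>"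
    using that not_less_Least unfolding succ_def by (metis not_le)
qed (use less_succ order_le_less_trans in blast)

lemma succ_eq_iff [simp]: "succ \<alpha> = succ \<beta> \<longleftrightarrow> \<alpha> = \<beta>"
  by (metis less_succ less_succ_iff order_antisym)

lemma succ_neq_zero [simp]: "succ \<alpha> \<noteq> 0" "0 \<noteq> succ \<alpha>"
  using less_succ[of \<alpha>] zero_le_cord[of \<alpha>] by auto

lemma osup_upper:
  assumes "countable A" "\<alpha> \<in> A"
  shows "\<alpha> \<le> osup A"
proof -
  obtain \<beta> where "\<forall>\<alpha>\<in>A. \<alpha> \<le> \<beta>"
    using countable_bounded_cord[OF assms(1)] less_imp_le by blast
  hence "\<forall>\<alpha>\<in>A. \<alpha> \<le> osup A" unfolding osup_def by (rule LeastI)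
  thus ?thesis using assms(2) by blast
qed

lemma osup_least: "(\<And>\<alpha>. \<alpha> \<in> A \<Longrightarrow> \<alpha> \<le> \<beta>) \<Longrightarrow> osup A \<le> \<beta>"
  unfolding osup_def by (rule Least_le) blast

subsection \<open>Transfinite recursion\<close>

function ord_rec :: "'b \<Rightarrow> ('b \<Rightarrow> 'b) \<Rightarrow> ('b set \<Rightarrow> 'b) \<Rightarrow> cord \<Rightarrow> 'b" where
  "ord_rec z s l \<alpha> =
     (if \<alpha> = 0 then z
      else if \<exists>\<beta>. \<alpha> = succ \<beta> then s (ord_rec z s l (THE \<beta>. \<alpha> = succ \<beta>))
      else l (ord_rec z s l ` {..<\<alpha>}))"
  by pat_completeness auto
termination
  by (relation "inv_image {(\<alpha>, \<beta>). \<alpha> < \<beta>} (\<lambda>(z, s, l, \<alpha>). \<alpha>)")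
     (auto simp: wf less_succ)

declare ord_rec.simps [simp del]

lemma ord_rec_zero: "ord_rec z s l 0 = z"
  by (simp add: ord_rec.simps)

lemma ord_rec_succ: "ord_rec z s l (succ \<alpha>) = s (ord_rec z s l \<alpha>)"
  by (subst ord_rec.simps) simp

lemma ord_rec_limit: "is_limit \<alpha> \<Longrightarrow> ord_rec z s l \<alpha> = l (ord_rec z s l ` {..<\<alpha>})"
  by (subst ord_rec.simps) (simp add: is_limit_def)

subsection \<open>Ordinal arithmetic\<close>

instantiation cord :: "{plus, times}"
begin
definition plus_cord :: "cord \<Rightarrow> cord \<Rightarrow> cord" where
  "\<alpha> + \<beta> = ord_rec \<alpha> succ osup \<beta>"
definition times_cord :: "cord \<Rightarrow> cord \<Rightarrow> cord" where
  "\<alpha> * \<beta> = ord_rec 0 (\<lambda>\<gamma>. \<gamma> + \<alpha>) osup \<beta>"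
instance ..
end

definition omega :: cord where
  "omega = (LEAST \<alpha>. is_limit \<alpha>)"

definition omega_pow :: "cord \<Rightarrow> cord" where
  "omega_pow = ord_rec 1 (\<lambda>\<gamma>. \<gamma> * omega) osup"

lemma ex_limit: "\<exists>\<alpha>. is_limit \<alpha>"
proof (rule ccontr)
  assume none: "\<not> ?thesis"
  have "\<alpha> \<in> range (\<lambda>n. (succ ^^ n) 0)" for \<alpha>
  proof (induction \<alpha> rule: less_induct)
    case (less \<alpha>)
    show ?case
    proof (cases "\<alpha> = 0")
      case True
      show ?thesis by (rule image_eqI[of _ _ 0]) (simp_all add: True)
    next
      case False
      then obtain \<beta> where \<beta>: "\<alpha> = succ \<beta>" using none by (auto simp: is_limit_def)
      then obtain n where "\<beta> = (succ ^^ n) 0" using less[of \<beta>] less_succ by auto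
      thus ?thesis by (intro image_eqI[of _ _ "Suc n"]) (simp_all add: \<beta>)
    qed
  qed
  hence "(UNIV :: cord set) = range (\<lambda>n. (succ ^^ n) 0)" by blast
  thus False using uncountable_UNIV_cord by (metis countableI_type countable_image)
qed

section \<open>Trees\<close>

text \<open>Finite sequences are lists; a tree contains only sequences of length at least one.\<close>

definition is_tree :: "'a list set \<Rightarrow> bool" where
  "is_tree T \<longleftrightarrow> [] \<notin> T \<and> (\<forall>xs x. xs \<noteq> [] \<longrightarrow> xs @ [x] \<in> T \<longrightarrow> xs \<in> T)"

definition tree_D :: "'a list set \<Rightarrow> 'a list set" where
  "tree_D T = {xs. xs \<noteq> [] \<and> (\<exists>x. xs @ [x] \<in> T)}"

definition tree_D_iter :: "cord \<Rightarrow> 'a list set \<Rightarrow> 'a list set" where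
  "tree_D_iter \<alpha> T = ord_rec T tree_D Inter \<alpha>"

lemma tree_D_iter_zero: "tree_D_iter 0 T = T"
  by (simp add: tree_D_iter_def ord_rec_zero)

lemma tree_D_iter_succ: "tree_D_iter (succ \<alpha>) T = tree_D (tree_D_iter \<alpha> T)"
  by (simp add: tree_D_iter_def ord_rec_succ)

lemma tree_D_iter_limit: "is_limit \<alpha> \<Longrightarrow> tree_D_iter \<alpha> T = (\<Inter>\<beta><\<alpha>. tree_D_iter \<beta> T)"
  by (simp add: tree_D_iter_def ord_rec_limit)

definition well_founded_tree :: "'a list set \<Rightarrow> bool" where
  "well_founded_tree T \<longleftrightarrow> (\<nexists>x :: nat \<Rightarrow> 'a. \<forall>k\<ge>1. map x [0..<k] \<in> T)"

text \<open>
  \<open>o(T) = \<alpha>\<close>, for a countable ordinal \<open>\<alpha>\<close>. This is a relation rather than a function since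
  the order of a well-founded tree with uncountably many elements need not be countable.
\<close>

definition has_tree_order :: "'a list set \<Rightarrow> cord \<Rightarrow> bool" where
  "has_tree_order T \<alpha> \<longleftrightarrow> well_founded_tree T \<and>
     tree_D_iter \<alpha> T = {} \<and> (\<forall>\<beta>. tree_D_iter \<beta> T = {} \<longrightarrow> \<alpha> \<le> \<beta>)"

section \<open>Sequences in Banach spaces\<close>

text \<open>
  Two-sided \<open>C\<close>-equivalence; \<open>\<Sum>i<k. \<bar>a i\<bar>\<close> is the \<open>\<ell>\<^sub>1\<^sup>k\<close>-norm of the combination of the
  unit vectors with coefficients \<open>a i\<close>.
\<close>

definition equiv_l1_basis :: "real \<Rightarrow> 'a::real_normed_vector list \<Rightarrow> bool" where
  "equiv_l1_basis C xs \<longleftrightarrow> (\<forall>a :: nat \<Rightarrow> real.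
     (1 / C) * (\<Sum>i<length xs. \<bar>a i\<bar>) \<le> norm (\<Sum>i<length xs. a i *\<^sub>R (xs ! i)) \<and>
     norm (\<Sum>i<length xs. a i *\<^sub>R (xs ! i)) \<le> C * (\<Sum>i<length xs. \<bar>a i\<bar>))"

definition is_l1_tree :: "'a::real_normed_vector list set \<Rightarrow> bool" where
  "is_l1_tree T \<longleftrightarrow> is_tree T \<and>
     (\<exists>C\<ge>1. \<forall>xs\<in>T. (\<forall>x\<in>set xs. norm x = 1) \<and> equiv_l1_basis C xs)"

text \<open>The finite sequence \<open>(e\<^sub>n)\<^sub>n\<^sub>\<in>\<^sub>F\<close>, in increasing order of the indices.\<close>

definition subseq_on :: "(nat \<Rightarrow> 'a) \<Rightarrow> nat set \<Rightarrow> 'a list" where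
  "subseq_on e F = map e (sorted_list_of_set F)"

definition schauder_basis_of :: "'a::real_normed_vector set \<Rightarrow> (nat \<Rightarrow> 'a) \<Rightarrow> bool" where
  "schauder_basis_of V e \<longleftrightarrow> range e \<subseteq> V \<and>
     (\<forall>v\<in>V. \<exists>!a :: nat \<Rightarrow> real. (\<lambda>n. a n *\<^sub>R e n) sums v)"

definition basic_sequence :: "(nat \<Rightarrow> 'a::real_normed_vector) \<Rightarrow> bool" where
  "basic_sequence x \<longleftrightarrow> schauder_basis_of (closure (span (range x))) x"

section \<open>Schreier families\<close>

text \<open>
  \<open>\<phi> \<xi> n\<close> is the \<open>n\<close>-th term \<open>\<xi>\<^sub>n\<close> of the sequence fixed for the limit ordinal \<open>\<xi>\<close>.
  Schreier families live on the positive integers, so \<open>\<phi> \<xi> 0\<close> is irrelevant.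
  The sequence is only required to be nondecreasing, which includes the strictly increasing ones.
\<close>

definition fundamental_sequences :: "(cord \<Rightarrow> nat \<Rightarrow> cord) \<Rightarrow> bool" where
  "fundamental_sequences \<phi> \<longleftrightarrow> (\<forall>\<xi>. is_limit \<xi> \<longrightarrow>
     mono_on {1..} (\<phi> \<xi>) \<and> (\<forall>n\<ge>1. \<phi> \<xi> n < \<xi>) \<and> (\<forall>\<eta><\<xi>. \<exists>n\<ge>1. \<eta> < \<phi> \<xi> n))"

text \<open>
  In the successor rule some \<open>F i\<close> may be empty; the order conditions are imposed on all
  pairs of sets, so empty sets do not affect the union.
\<close>

inductive_set schreier_graph :: "(cord \<Rightarrow> nat \<Rightarrow> cord) \<Rightarrow> (cord \<times> nat set) set"
  for \<phi> :: "cord \<Rightarrow> nat \<Rightarrow> cord" where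
  empty: "(0, {}) \<in> schreier_graph \<phi>"
| singleton: "n \<ge> 1 \<Longrightarrow> (0, {n}) \<in> schreier_graph \<phi>"
| succ: "\<lbrakk>m \<ge> 1; \<forall>i\<in>{1..m}. (\<xi>, F i) \<in> schreier_graph \<phi>;
    \<forall>i\<in>{1..m}. \<forall>p\<in>F i. m \<le> p;
    \<forall>i\<in>{1..m}. \<forall>j\<in>{1..m}. i < j \<longrightarrow> (\<forall>p\<in>F i. \<forall>q\<in>F j. p < q)\<rbrakk>
    \<Longrightarrow> (succ \<xi>, \<Union>i\<in>{1..m::nat}. F i) \<in> schreier_graph \<phi>"
| limit: "\<lbrakk>is_limit \<xi>; n \<ge> 1; (\<phi> \<xi> n, F) \<in> schreier_graph \<phi>; \<forall>p\<in>F. n \<le> p\<rbrakk>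
    \<Longrightarrow> (\<xi>, F) \<in> schreier_graph \<phi>"

definition schreier :: "(cord \<Rightarrow> nat \<Rightarrow> cord) \<Rightarrow> cord \<Rightarrow> nat set set" where
  "schreier \<phi> \<xi> = {F. (\<xi>, F) \<in> schreier_graph \<phi>}"

lemma schreier_zero: "schreier \<phi> 0 = {{n} |n. n \<ge> 1} \<union> {{}}"
proof
  show "schreier \<phi> 0 \<subseteq> {{n} |n. n \<ge> 1} \<union> {{}}"
  proof
    fix F assume "F \<in> schreier \<phi> 0"
    hence "(0, F) \<in> schreier_graph \<phi>" by (simp add: schreier_def)
    thus "F \<in> {{n} |n. n \<ge> 1} \<union> {{}}"
      by cases (auto simp: is_limit_def)
  qed
qed (auto simp: schreier_def intro: schreier_graph.empty schreier_graph.singleton)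

lemma schreier_succ:
  "schreier \<phi> (succ \<xi>) = {\<Union>i\<in>{1..m::nat}. F i |m F.
     m \<ge> 1 \<and> (\<forall>i\<in>{1..m}. F i \<in> schreier \<phi> \<xi>) \<and> (\<forall>i\<in>{1..m}. \<forall>p\<in>F i. m \<le> p) \<and>
     (\<forall>i\<in>{1..m}. \<forall>j\<in>{1..m}. i < j \<longrightarrow> (\<forall>p\<in>F i. \<forall>q\<in>F j. p < q))}" (is "?L = ?R")
proof
  show "?L \<subseteq> ?R"
  proof
    fix G assume "G \<in> ?L"
    hence "(succ \<xi>, G) \<in> schreier_graph \<phi>" by (simp add: schreier_def)
    thus "G \<in> ?R"
    proof cases
      case (succ m \<eta> F)
      hence "\<eta> = \<xi>" by simp
      thus ?thesis using succ unfolding schreier_def mem_Collect_eq by blast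
    qed (auto simp: is_limit_def)
  qed
  show "?R \<subseteq> ?L"
  proof
    fix G assume "G \<in> ?R"
    then obtain m F where G: "G = (\<Union>i\<in>{1..m::nat}. F i)" and "m \<ge> 1"
      "\<forall>i\<in>{1..m}. F i \<in> schreier \<phi> \<xi>" "\<forall>i\<in>{1..m}. \<forall>p\<in>F i. m \<le> p"
      "\<forall>i\<in>{1..m}. \<forall>j\<in>{1..m}. i < j \<longrightarrow> (\<forall>p\<in>F i. \<forall>q\<in>F j. p < q)"
      by blast
    thus "G \<in> ?L"
      unfolding schreier_def G mem_Collect_eq by (intro schreier_graph.succ)
  qed
qed

lemma schreier_limit:
  assumes "is_limit \<xi>"
  shows "schreier \<phi> \<xi> = {F. \<exists>n\<ge>1. F \<in> schreier \<phi> (\<phi> \<xi> n) \<and> (\<forall>p\<in>F. n \<le> p)}" (is "?L = ?R")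
proof
  show "?L \<subseteq> ?R"
  proof
    fix G assume "G \<in> ?L"
    hence "(\<xi>, G) \<in> schreier_graph \<phi>" by (simp add: schreier_def)
    thus "G \<in> ?R"
      by cases (use assms in \<open>auto simp: is_limit_def schreier_def\<close>)
  qed
  show "?R \<subseteq> ?L"
    unfolding schreier_def using schreier_graph.limit[OF assms] by blast
qed

text \<open>
  Sequences are indexed from \<open>0\<close> but Schreier sets consist of positive integers, so the \<open>i\<close>-th
  term of the sequence is \<open>x (i - 1)\<close>.
\<close>

definition generates_l1_spreading_model ::
    "(cord \<Rightarrow> nat \<Rightarrow> cord) \<Rightarrow> cord \<Rightarrow> (nat \<Rightarrow> 'a::real_normed_vector) \<Rightarrow> bool" where
  "generates_l1_spreading_model \<phi> \<xi> x \<longleftrightarrow> (\<forall>n. norm (x n) = 1) \<and> basic_sequence x \<and>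
     (\<exists>C\<ge>1. \<forall>F\<in>schreier \<phi> \<xi>. equiv_l1_basis C (subseq_on (\<lambda>i. x (i - 1)) F))"

end

theory Submission
  imports Defs
begin

text \<open>
  Two prefix-closed families \<open>G\<close> and \<open>F\<close> of finite increasing sequences, \<open>G\<close> well-founded, satisfy
  a Ramsey dichotomy: below every infinite set there is an infinite \<open>L\<close> with \<open>G[L] \<subseteq> F\<close> or
  \<open>F[L] \<subseteq> G\<close>. For \<open>\<xi> > 0\<close> the elements of \<open>\<S>\<^sub>\<xi>\<close> with minimum \<open>k\<close> are covered by \<open>k\<close>
  families \<open>B 1, \<dots>, B k\<close> of rank strictly below \<open>\<omega>\<^sup>\<xi>\<close>, and \<open>F\<close> is the family of sets on which
  \<open>e\<close> is \<open>C\<close>-equivalent to the \<open>\<ell>\<^sub>1\<close> basis. The alternative \<open>F[L] \<subseteq> B n\<close> bounds the rank of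
  \<open>F[L]\<close> below \<open>\<omega>\<^sup>\<xi>\<close>; diagonalising over \<open>C = 0, 1, \<dots>\<close> against the trees of order
  \<open>\<omega>\<^sup>\<xi>\<close> shows that it is avoidable for some fixed \<open>C\<close>, since finitely many initial elements of
  \<open>L\<close> only add a finite ordinal to the rank. A second diagonalisation, over \<open>n\<close>, then gives
  \<open>B n[L\<^sub>n] \<subseteq> F\<close> along a decreasing sequence, and, as \<open>B n\<close> is closed under spreading, the
  diagonal subsequence generates an \<open>\<ell>\<^sub>1\<^sup>\<xi>\<close>-spreading model. It is basic because the coefficient
  functionals of a Schauder basis are continuous, by Baire's theorem.
\<close>

section \<open>Ordinal arithmetic\<close>

lemma cord_cases [case_names zero succ limit]:
  obtains "\<alpha> = 0" | \<beta> where "\<alpha> = succ \<beta>" | "is_limit \<alpha>"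
  unfolding is_limit_def by blast

lemma cord_induct [case_names zero succ limit]:
  assumes "P 0" "\<And>\<alpha>. P \<alpha> \<Longrightarrow> P (succ \<alpha>)"
    "\<And>\<alpha>. is_limit \<alpha> \<Longrightarrow> (\<And>\<beta>. \<beta> < \<alpha> \<Longrightarrow> P \<beta>) \<Longrightarrow> P \<alpha>"
  shows "P \<alpha>"
proof (induction \<alpha> rule: less_induct)
  case (less \<alpha>)
  show ?case
    by (cases \<alpha> rule: cord_cases) (use assms less less_succ in auto)
qed

lemma zero_less_cord: "0 < \<alpha> \<longleftrightarrow> \<alpha> \<noteq> (0 :: cord)"
  using zero_le_cord[of \<alpha>] by auto

lemma succ_le_iff: "succ \<alpha> \<le> \<beta> \<longleftrightarrow> \<alpha> < \<beta>"
  by (meson less_succ_iff not_le)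

lemma succ_less_limit: "is_limit \<alpha> \<Longrightarrow> \<beta> < \<alpha> \<Longrightarrow> succ \<beta> < \<alpha>"
  by (metis is_limit_def order_le_less succ_le_iff)

lemma less_osupD: "\<alpha> < osup A \<Longrightarrow> \<exists>\<beta>\<in>A. \<alpha> < \<beta>"
  using osup_least[of A \<alpha>] by (meson not_le)

text \<open>\<open>osup\<close> is defined by a least element and is an upper bound only for bounded
  sets; images of initial segments are bounded, being countable.\<close>

lemma le_osup_image: "\<beta> < \<alpha> \<Longrightarrow> f \<beta> \<le> osup (f ` {..<\<alpha>})" for \<alpha> \<beta> :: cord
  by (rule osup_upper) (auto simp: countable_lessThan_cord)

lemma plus_zero_cord [simp]: "\<alpha> + 0 = (\<alpha> :: cord)"
  by (simp add: plus_cord_def ord_rec_zero)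

lemma plus_succ [simp]: "\<alpha> + succ \<beta> = succ (\<alpha> + \<beta>)"
  by (simp add: plus_cord_def ord_rec_succ)

lemma plus_limit: "is_limit \<beta> \<Longrightarrow> \<alpha> + \<beta> = osup ((+) \<alpha> ` {..<\<beta>})"
  by (simp add: plus_cord_def ord_rec_limit)

lemma times_zero_cord [simp]: "\<alpha> * 0 = (0 :: cord)"
  by (simp add: times_cord_def ord_rec_zero)

lemma times_succ [simp]: "\<alpha> * succ \<beta> = \<alpha> * \<beta> + \<alpha>"
  by (simp add: times_cord_def ord_rec_succ)

lemma times_limit: "is_limit \<beta> \<Longrightarrow> \<alpha> * \<beta> = osup ((*) \<alpha> ` {..<\<beta>})"
  by (simp add: times_cord_def ord_rec_limit)

lemma plus_strict_mono_cord: "\<beta> < \<gamma> \<Longrightarrow> \<alpha> + \<beta> < \<alpha> + (\<gamma> :: cord)"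
proof (induction \<gamma> rule: cord_induct)
  case zero
  thus ?case using zero_le_cord[of \<beta>] by simp
next
  case (succ \<gamma>)
  thus ?case by (metis less_succ_iff order_le_less plus_succ)
next
  case (limit \<gamma>)
  have "\<alpha> + \<beta> < \<alpha> + succ \<beta>" by (simp add: less_succ)
  also have "\<dots> \<le> \<alpha> + \<gamma>"
    unfolding plus_limit[OF limit(1)] by (rule le_osup_image) (rule succ_less_limit[OF limit(1,3)])
  finally show ?case .
qed

lemma le_plus_cord: "\<alpha> \<le> \<alpha> + (\<beta> :: cord)"
  using plus_strict_mono_cord[of 0 \<beta> \<alpha>]
  by (cases "\<beta> = 0") (auto simp: zero_less_cord less_imp_le)

lemma zero_plus_cord [simp]: "0 + \<alpha> = (\<alpha> :: cord)"
proof (induction \<alpha> rule: cord_induct)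
  case (limit \<alpha>)
  have "(+) 0 ` {..<\<alpha>} = {..<\<alpha>}" using limit(2) by force
  moreover have "osup {..<\<alpha>} = \<alpha>"
  proof (rule antisym)
    show "\<alpha> \<le> osup {..<\<alpha>}"
      using less_succ succ_less_limit[OF limit(1)] osup_upper[OF countable_lessThan_cord]
      by (metis lessThan_iff not_le)
  qed (auto intro: osup_least)
  ultimately show ?case using limit(1) by (simp add: plus_limit)
qed auto

section \<open>Finite ordinals and \<omega>\<close>

definition ord_of_nat :: "nat \<Rightarrow> cord" where
  "ord_of_nat n = (succ ^^ n) 0"

lemma ord_of_nat_0 [simp]: "ord_of_nat 0 = 0"
  and ord_of_nat_Suc [simp]: "ord_of_nat (Suc n) = succ (ord_of_nat n)"
  by (simp_all add: ord_of_nat_def)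

lemma ord_of_nat_strict_mono: "m < n \<Longrightarrow> ord_of_nat m < ord_of_nat n"
  by (induction n) (auto simp: less_Suc_eq less_succ intro: less_trans)

lemma is_limit_omega: "is_limit omega"
  unfolding omega_def by (rule LeastI_ex[OF ex_limit])

lemma ord_of_nat_less_limit: "is_limit \<alpha> \<Longrightarrow> ord_of_nat n < \<alpha>"
  by (induction n) (auto simp: zero_less_cord succ_less_limit is_limit_def)

lemma less_omegaD: "\<alpha> < omega \<Longrightarrow> \<exists>n. \<alpha> = ord_of_nat n"
proof (induction \<alpha> rule: cord_induct)
  case zero
  show ?case by (metis ord_of_nat_0)
next
  case (succ \<alpha>)
  thus ?case by (metis less_succ less_trans ord_of_nat_Suc)
next
  case (limit \<alpha>)
  thus ?case using not_less_Least unfolding omega_def by blast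
qed

section \<open>Powers of \<omega>\<close>

lemma omega_pow_zero: "omega_pow 0 = 1"
  by (simp add: omega_pow_def ord_rec_zero)

lemma omega_pow_succ: "omega_pow (succ \<alpha>) = omega_pow \<alpha> * omega"
  by (simp add: omega_pow_def ord_rec_succ)

lemma omega_pow_limit: "is_limit \<alpha> \<Longrightarrow> omega_pow \<alpha> = osup (omega_pow ` {..<\<alpha>})"
  by (simp add: omega_pow_def ord_rec_limit)

lemma times_ord_of_nat_less:
  assumes "0 < \<alpha>"
  shows "\<alpha> * ord_of_nat n < \<alpha> * omega"
proof -
  have "\<alpha> * ord_of_nat n < \<alpha> * ord_of_nat (Suc n)"
    using plus_strict_mono_cord[OF assms, of "\<alpha> * ord_of_nat n"] by simp
  also have "\<dots> \<le> \<alpha> * omega"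
    unfolding times_limit[OF is_limit_omega]
    by (rule le_osup_image) (rule ord_of_nat_less_limit[OF is_limit_omega])
  finally show ?thesis .
qed

lemma omega_pow_pos: "0 < omega_pow \<alpha>"
proof (induction \<alpha> rule: cord_induct)
  case zero
  show ?case by (simp add: omega_pow_zero one_cord_def less_succ)
next
  case (succ \<alpha>)
  thus ?case using times_ord_of_nat_less[of "omega_pow \<alpha>" 0] by (simp add: omega_pow_succ)
next
  case (limit \<alpha>)
  hence "0 < \<alpha>" by (simp add: is_limit_def zero_less_cord)
  thus ?case
    using le_osup_image[of 0 \<alpha> omega_pow] limit omega_pow_limit by (metis order_less_le_trans)
qed

lemma omega_pow_less_succ: "omega_pow \<alpha> < omega_pow (succ \<alpha>)"
  using times_ord_of_nat_less[OF omega_pow_pos, of \<alpha> 1] by (simp add: omega_pow_succ)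

lemma omega_pow_less_limit: "is_limit \<alpha> \<Longrightarrow> \<beta> < \<alpha> \<Longrightarrow> omega_pow \<beta> < omega_pow \<alpha>"
  using omega_pow_less_succ[of \<beta>] le_osup_image[OF succ_less_limit, of \<alpha> \<beta> omega_pow]
  by (simp add: omega_pow_limit)

text \<open>For \<xi> \<noteq> 0 the power is a supremum of ordinals strictly below it, namely
  finite multiples of the preceding power or earlier powers. If \<beta> lies below one of them, then
  \<open>succ \<beta>\<close> is at most that one.\<close>

lemma succ_less_omega_pow:
  assumes "\<xi> \<noteq> 0" "\<beta> < omega_pow \<xi>"
  shows "succ \<beta> < omega_pow \<xi>"
proof (cases \<xi> rule: cord_cases)
  case (succ \<eta>)
  obtain n where "\<beta> < omega_pow \<eta> * ord_of_nat n"
    using assms(2) less_osupD less_omegaD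
    unfolding succ omega_pow_succ times_limit[OF is_limit_omega] by force
  thus ?thesis
    using times_ord_of_nat_less[OF omega_pow_pos, of \<eta> n]
    unfolding succ omega_pow_succ by (meson order_le_less_trans succ_le_iff)
next
  case limit
  obtain \<eta> where "\<eta> < \<xi>" "\<beta> < omega_pow \<eta>"
    using assms(2) less_osupD unfolding omega_pow_limit[OF limit] by force
  thus ?thesis
    using omega_pow_less_limit[OF limit] by (meson order_le_less_trans succ_le_iff)
qed (use assms in auto)

lemma plus_ord_of_nat_less_omega_pow:
  assumes "\<xi> \<noteq> 0" "\<beta> < omega_pow \<xi>"
  shows "\<beta> + ord_of_nat n < omega_pow \<xi>"
  by (induction n) (use assms succ_less_omega_pow in auto)

section \<open>Ranked families of finite sequences\<close>

text \<open>In contrast to \<open>is_tree\<close>, a nonempty family of this kind contains the empty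
  sequence; this keeps both factors inside their concatenation.\<close>

definition prefix_closed :: "'a list set \<Rightarrow> bool" where
  "prefix_closed A \<longleftrightarrow> (\<forall>s t. s @ t \<in> A \<longrightarrow> s \<in> A)"

text \<open>As in the definition of the order of a tree, the empty sequence is not ranked.\<close>

definition rank_fun :: "'a list set \<Rightarrow> cord \<Rightarrow> ('a list \<Rightarrow> cord) \<Rightarrow> bool" where
  "rank_fun A \<alpha> \<rho> \<longleftrightarrow> (\<forall>s x. s \<noteq> [] \<longrightarrow> s @ [x] \<in> A \<longrightarrow> \<rho> (s @ [x]) < \<rho> s) \<and>
     (\<forall>s\<in>A. s \<noteq> [] \<longrightarrow> \<rho> s < \<alpha>)"

text \<open>A rank function certifies that the order is at most \<alpha>. All constructions work
  with such certificates; \<open>ranked_tree_D_iter\<close> translates them back to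
  derivatives.\<close>

definition ranked :: "'a list set \<Rightarrow> cord \<Rightarrow> bool" where
  "ranked A \<alpha> \<longleftrightarrow> (\<exists>\<rho>. rank_fun A \<alpha> \<rho>)"

lemma rank_funD:
  assumes "rank_fun A \<alpha> \<rho>"
  shows "s \<noteq> [] \<Longrightarrow> s @ [x] \<in> A \<Longrightarrow> \<rho> (s @ [x]) < \<rho> s"
    and "s \<in> A \<Longrightarrow> s \<noteq> [] \<Longrightarrow> \<rho> s < \<alpha>"
  using assms unfolding rank_fun_def by blast+

lemma rankedI:
  assumes "\<And>s x. s \<noteq> [] \<Longrightarrow> s @ [x] \<in> A \<Longrightarrow> \<rho> (s @ [x]) < \<rho> s"
    "\<And>s. s \<in> A \<Longrightarrow> s \<noteq> [] \<Longrightarrow> \<rho> s < \<alpha>"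
  shows "ranked A \<alpha>"
  unfolding ranked_def rank_fun_def by (rule exI[of _ \<rho>]) (use assms in blast)

lemma ranked_mono: "ranked A \<alpha> \<Longrightarrow> B \<subseteq> A \<Longrightarrow> \<alpha> \<le> \<beta> \<Longrightarrow> ranked B \<beta>"
  unfolding ranked_def rank_fun_def by (elim exE, intro exI) (auto intro: order_less_le_trans)

text \<open>Each derivative requires one more extension, and an extension lowers the rank strictly.
  Hence what survives \<beta> derivatives has rank at least \<beta>, and no rank reaches
  \<alpha>.\<close>

lemma ranked_tree_D_iter:
  assumes "ranked A \<alpha>" "is_tree A"
  shows "tree_D_iter \<alpha> A = {}"
proof -
  obtain \<rho> where "rank_fun A \<alpha> \<rho>"
    using assms(1) unfolding ranked_def by blast
  note \<rho> = rank_funD[OF this]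
  have "tree_D_iter \<beta> A \<subseteq> {s \<in> A. \<beta> \<le> \<rho> s}" for \<beta>
  proof (induction \<beta> rule: cord_induct)
    case zero
    show ?case by (auto simp: tree_D_iter_zero zero_le_cord)
  next
    case (succ \<beta>)
    show ?case
    proof
      fix s assume "s \<in> tree_D_iter (succ \<beta>) A"
      then obtain x where "s \<noteq> []" "s @ [x] \<in> tree_D_iter \<beta> A"
        unfolding tree_D_iter_succ tree_D_def by blast
      moreover from this have "s @ [x] \<in> A" "\<beta> \<le> \<rho> (s @ [x])" using succ by blast+
      ultimately show "s \<in> {s \<in> A. succ \<beta> \<le> \<rho> s}"
        using \<rho>(1)[of s x] assms(2) unfolding is_tree_def succ_le_iff
        by (blast intro: order_le_less_trans)
    qed
  next
    case (limit \<beta>)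
    have "s \<in> A \<and> \<beta> \<le> \<rho> s" if s: "s \<in> tree_D_iter \<beta> A" for s
    proof -
      have *: "s \<in> A \<and> \<gamma> \<le> \<rho> s" if "\<gamma> < \<beta>" for \<gamma>
        using limit(2)[OF that] s that unfolding tree_D_iter_limit[OF limit(1)] by blast
      have "\<beta> \<le> \<rho> s"
      proof (rule ccontr)
        assume "\<not> \<beta> \<le> \<rho> s"
        hence "succ (\<rho> s) \<le> \<rho> s" using * succ_less_limit[OF limit(1)] by (meson not_le)
        thus False by (simp add: succ_le_iff)
      qed
      moreover have "0 < \<beta>" using limit(1) by (simp add: is_limit_def zero_less_cord)
      ultimately show ?thesis using * by blast
    qed
    thus ?case by blast
  qed
  hence "s \<in> A \<and> \<alpha> \<le> \<rho> s" if "s \<in> tree_D_iter \<alpha> A" for s using that by blast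
  moreover have "[] \<notin> A" using assms(2) by (simp add: is_tree_def)
  ultimately show ?thesis using \<rho>(2) by (metis equals0I not_le)
qed

text \<open>Carries a rank from index lists to lists of vectors: it is read off the unique
  preimage.\<close>

lemma ranked_image_map:
  assumes "ranked A \<alpha>" "inj f"
  shows "ranked (map f ` A) \<alpha>"
proof -
  obtain \<rho> where "rank_fun A \<alpha> \<rho>"
    using assms(1) unfolding ranked_def by blast
  note \<rho> = rank_funD[OF this]
  have inv: "map (inv f) (map f s) = s" for s using assms(2) by (simp add: o_def)
  show ?thesis
  proof (rule rankedI[where \<rho> = "\<lambda>s. \<rho> (map (inv f) s)"])
    fix s x assume "s \<noteq> []" and "s @ [x] \<in> map f ` A"
    then obtain u where u: "u \<in> A" "s @ [x] = map f u" by blast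
    hence "u = map (inv f) s @ [inv f x]" using inv[of u] by (metis list.simps(8,9) map_append)
    thus "\<rho> (map (inv f) (s @ [x])) < \<rho> (map (inv f) s)"
      using \<rho>(1)[of "map (inv f) s" "inv f x"] u(1) \<open>s \<noteq> []\<close> by simp
  next
    fix s assume "s \<in> map f ` A" "s \<noteq> []"
    thus "\<rho> (map (inv f) s) < \<alpha>" using \<rho>(2) inv by force
  qed
qed

text \<open>Use the larger of the two ranks where both apply. An extension may leave one family but,
  by prefix-closedness, cannot enter a new one, so the maximum still drops.\<close>

lemma ranked_Un:
  assumes "ranked A \<alpha>" "ranked B \<alpha>" "prefix_closed A" "prefix_closed B"
  shows "ranked (A \<union> B) \<alpha>"
proof -
  obtain \<rho> where "rank_fun A \<alpha> \<rho>"
    using assms(1) unfolding ranked_def by blast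
  note \<rho> = rank_funD[OF this]
  obtain \<sigma> where "rank_fun B \<alpha> \<sigma>"
    using assms(2) unfolding ranked_def by blast
  note \<sigma> = rank_funD[OF this]
  define \<tau> where "\<tau> s = (if s \<in> A \<and> s \<in> B then max (\<rho> s) (\<sigma> s) else if s \<in> A then \<rho> s else \<sigma> s)"
    for s
  show ?thesis
  proof (rule rankedI[where \<rho> = \<tau>])
    fix s x assume s: "s \<noteq> []" "s @ [x] \<in> A \<union> B"
    have "s @ [x] \<in> A \<Longrightarrow> s \<in> A" "s @ [x] \<in> B \<Longrightarrow> s \<in> B"
      using assms(3,4) unfolding prefix_closed_def by blast+
    thus "\<tau> (s @ [x]) < \<tau> s"
      using \<rho>(1)[OF s(1), of x] \<sigma>(1)[OF s(1), of x] s(2)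
      by (auto simp: \<tau>_def less_max_iff_disj)
  next
    fix s assume "s \<in> A \<union> B" "s \<noteq> []"
    thus "\<tau> s < \<alpha>" using \<rho>(2)[of s] \<sigma>(2)[of s] by (auto simp: \<tau>_def)
  qed
qed

lemma prefix_closed_Union: "(\<And>i. i \<in> I \<Longrightarrow> prefix_closed (A i)) \<Longrightarrow> prefix_closed (\<Union>i\<in>I. A i)"
  unfolding prefix_closed_def by blast

lemma ranked_UN:
  assumes "finite I" "\<And>i. i \<in> I \<Longrightarrow> ranked (A i) \<alpha>" "\<And>i. i \<in> I \<Longrightarrow> prefix_closed (A i)"
  shows "ranked (\<Union>i\<in>I. A i) \<alpha>"
  using assms
proof (induction I rule: finite_induct)
  case (insert i I)
  thus ?case using prefix_closed_Union[of I A] by (simp add: ranked_Un)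
qed (simp add: ranked_def rank_fun_def)

text \<open>A nonempty sequence and its extensions have the same head, so ranks chosen separately
  for each head fit together. The empty sequence carries no rank, hence the bound does not
  grow.\<close>

lemma ranked_if_ranked_hd:
  assumes "\<And>k. ranked {s \<in> A. s \<noteq> [] \<and> hd s = k} \<alpha>"
  shows "ranked A \<alpha>"
proof -
  obtain \<rho> where \<rho>: "rank_fun {s \<in> A. s \<noteq> [] \<and> hd s = k} \<alpha> (\<rho> k)" for k
    using assms unfolding ranked_def by metis
  show ?thesis
  proof (rule rankedI[where \<rho> = "\<lambda>s. \<rho> (hd s) s"])
    fix s x assume "s \<noteq> []" "s @ [x] \<in> A"
    thus "\<rho> (hd (s @ [x])) (s @ [x]) < \<rho> (hd s) s"
      using rank_funD(1)[OF \<rho>, of s x "hd s"] by simp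
  next
    fix s assume "s \<in> A" "s \<noteq> []"
    thus "\<rho> (hd s) s < \<alpha>" using rank_funD(2)[OF \<rho>, of s "hd s"] by simp
  qed
qed

section \<open>Concatenation of families\<close>

definition conc :: "'a list set \<Rightarrow> 'a list set \<Rightarrow> 'a list set" where
  "conc A B = {s @ t |s t. s \<in> A \<and> t \<in> B}"

lemma prefix_closed_conc:
  assumes "prefix_closed A" "prefix_closed B" "[] \<in> B"
  shows "prefix_closed (conc A B)"
  unfolding prefix_closed_def
proof (intro allI impI)
  fix s t assume "s @ t \<in> conc A B"
  then obtain a b where ab: "s @ t = a @ b" "a \<in> A" "b \<in> B" unfolding conc_def by blast
  then consider u where "s @ u = a" | u where "s = a @ u" "u @ t = b"
    by (metis append_eq_append_conv2)
  thus "s \<in> conc A B"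
  proof cases
    case (1 u)
    hence "s \<in> A" using ab(2) assms(1) unfolding prefix_closed_def by blast
    thus ?thesis using assms(3) unfolding conc_def by force
  next
    case (2 u)
    hence "u \<in> B" using ab(3) assms(2) unfolding prefix_closed_def by blast
    thus ?thesis using 2 ab(2) unfolding conc_def by blast
  qed
qed

text \<open>Sequences still in \<open>A\<close> are ranked above \<beta>, the others below \<beta>
  through their remainders in \<open>B\<close>; so \<open>B\<close> contributes the lower summand. A
  sequence may split in several ways, and the largest rank of a remainder is taken.\<close>

lemma ranked_conc:
  assumes "ranked A \<alpha>" "ranked B \<beta>" "prefix_closed A" "prefix_closed B"
  shows "ranked (conc A B) (\<beta> + \<alpha>)"
proof -
  obtain \<rho> where "rank_fun A \<alpha> \<rho>"
    using assms(1) unfolding ranked_def by blast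
  note \<rho> = rank_funD[OF this]
  obtain \<sigma> where "rank_fun B \<beta> \<sigma>"
    using assms(2) unfolding ranked_def by blast
  note \<sigma> = rank_funD[OF this]
  define P where "P s = {b \<in> B. b \<noteq> [] \<and> (\<exists>a\<in>A. s = a @ b)}" for s
  define \<tau> where "\<tau> s = (if s \<in> A then \<beta> + \<rho> s else Max (\<sigma> ` P s))" for s
  have fin: "finite (P s)" for s
  proof (rule finite_subset)
    show "P s \<subseteq> (\<lambda>n. drop n s) ` {..length s}"
    proof
      fix b assume "b \<in> P s"
      then obtain a where "s = a @ b" unfolding P_def by blast
      hence "b = drop (length a) s" "length a \<le> length s" by simp_all
      thus "b \<in> (\<lambda>n. drop n s) ` {..length s}" by blast
    qed
  qed simp
  have le: "\<sigma> b \<le> \<tau> s" if "b \<in> P s" "s \<notin> A" for b s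
    using that fin[of s] by (auto simp: \<tau>_def)
  have less: "\<tau> s < \<gamma>" if "s \<in> conc A B" "s \<notin> A" "\<And>b. b \<in> P s \<Longrightarrow> \<sigma> b < \<gamma>" for s \<gamma>
  proof -
    have "P s \<noteq> {}" using that(1,2) unfolding P_def conc_def by fastforce
    thus ?thesis using that(2,3) fin[of s] by (auto simp: \<tau>_def)
  qed
  have less_\<beta>: "\<tau> s < \<beta>" if "s \<in> conc A B" "s \<notin> A" for s
    using that by (rule less) (auto simp: P_def \<sigma>(2))
  show ?thesis
  proof (rule rankedI[where \<rho> = \<tau>])
    fix s x assume s: "s \<noteq> []" "s @ [x] \<in> conc A B"
    consider "s @ [x] \<in> A" "s \<in> A" | "s @ [x] \<notin> A" "s \<in> A" | "s @ [x] \<notin> A" "s \<notin> A"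
      using assms(3) unfolding prefix_closed_def by blast
    thus "\<tau> (s @ [x]) < \<tau> s"
    proof cases
      case 1
      thus ?thesis using \<rho>(1) s(1) by (simp add: \<tau>_def plus_strict_mono_cord)
    next
      case 2
      hence "\<tau> (s @ [x]) < \<beta>" using less_\<beta>[OF s(2)] by simp
      also have "\<dots> \<le> \<tau> s" using 2(2) by (simp add: \<tau>_def le_plus_cord)
      finally show ?thesis .
    next
      case 3
      show ?thesis
      proof (rule less[OF s(2) 3(1)])
        fix b assume "b \<in> P (s @ [x])"
        then obtain a where a: "a \<in> A" "s @ [x] = a @ b" and b: "b \<in> B" "b \<noteq> []"
          unfolding P_def by blast
        \<comment> \<open>Deleting \<open>x\<close> turns a splitting of \<open>s @ [x]\<close> into
          one of \<open>s\<close>; the remainder \<open>c\<close> is nonempty since \<open>s\<close>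
          is not in \<open>A\<close>.\<close>
        then obtain c where c: "b = c @ [x]" "s = a @ c"
          by (cases b rule: rev_cases) auto
        with a 3(2) have "c \<noteq> []" by auto
        moreover have "c \<in> P s"
          using a(1) b c \<open>c \<noteq> []\<close> assms(4) unfolding P_def prefix_closed_def by blast
        moreover have "\<sigma> b < \<sigma> c" using \<sigma>(1)[of c x] b(1) \<open>c \<noteq> []\<close> by (simp add: c(1))
        ultimately show "\<sigma> b < \<tau> s" using le[OF _ 3(2)] by (meson order_less_le_trans)
      qed
    qed
  next
    fix s assume "s \<in> conc A B" "s \<noteq> []"
    show "\<tau> s < \<beta> + \<alpha>"
    proof (cases "s \<in> A")
      case True
      thus ?thesis using \<rho>(2) \<open>s \<noteq> []\<close> by (simp add: \<tau>_def plus_strict_mono_cord)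
    next
      case False
      hence "\<tau> s < \<beta>" using less_\<beta> \<open>s \<in> conc A B\<close> by blast
      also have "\<dots> \<le> \<beta> + \<alpha>" by (rule le_plus_cord)
      finally show ?thesis .
    qed
  qed
qed

section \<open>Schreier families\<close>

lemma schreier_graph_finite: "(\<xi>, F) \<in> schreier_graph \<phi> \<Longrightarrow> finite F"
  by (induction \<xi> F rule: schreier_graph.induct) auto

lemma schreier_graph_subset:
  "(\<xi>, F) \<in> schreier_graph \<phi> \<Longrightarrow> G \<subseteq> F \<Longrightarrow> (\<xi>, G) \<in> schreier_graph \<phi>"
proof (induction \<xi> F arbitrary: G rule: schreier_graph.induct)
  case empty
  thus ?case by (simp add: schreier_graph.empty)
next
  case (singleton n)
  hence "G = {} \<or> G = {n}" by blast
  thus ?case using singleton(1) by (auto intro: schreier_graph.empty schreier_graph.singleton)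
next
  case (succ m \<xi> F)
  \<comment> \<open>Some of the blocks cut down to \<open>G\<close> may be empty, which the
    successor rule allows.\<close>
  have "(succ \<xi>, \<Union>i\<in>{1..m}. F i \<inter> G) \<in> schreier_graph \<phi>"
  proof (rule schreier_graph.succ)
    show "\<forall>i\<in>{1..m}. (\<xi>, F i \<inter> G) \<in> schreier_graph \<phi>"
      using succ.IH by (meson Int_lower1)
  qed (use succ.hyps in blast)+
  moreover have "(\<Union>i\<in>{1..m}. F i \<inter> G) = G" using succ.prems by blast
  ultimately show ?case by simp
next
  case (limit \<xi> n F)
  show ?case
    by (rule schreier_graph.limit[OF limit.hyps(1,2) limit.IH[OF limit.prems]])
       (use limit.hyps limit.prems in blast)
qed

text \<open>A strictly increasing \<open>r\<close> satisfies \<open>n \<le> r n\<close>, so lower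
  bounds on elements survive, and the order between blocks is kept.\<close>

lemma schreier_graph_spread:
  assumes "strict_mono (r :: nat \<Rightarrow> nat)"
  shows "(\<xi>, F) \<in> schreier_graph \<phi> \<Longrightarrow> (\<xi>, r ` F) \<in> schreier_graph \<phi>"
proof (induction \<xi> F rule: schreier_graph.induct)
  case empty
  thus ?case by (simp add: schreier_graph.empty)
next
  case (singleton n)
  thus ?case
    using strict_mono_imp_increasing[OF assms, of n] by (auto intro: schreier_graph.singleton)
next
  case (succ m \<xi> F)
  have "(succ \<xi>, \<Union>i\<in>{1..m}. r ` F i) \<in> schreier_graph \<phi>"
  proof (rule schreier_graph.succ)
    show "\<forall>i\<in>{1..m}. \<forall>p\<in>r ` F i. m \<le> p"
    proof (intro ballI)
      fix i p assume "i \<in> {1..m}" "p \<in> r ` F i"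
      then obtain q where "p = r q" "m \<le> q" using succ.hyps by blast
      thus "m \<le> p" using strict_mono_imp_increasing[OF assms, of q] by simp
    qed
    show "\<forall>i\<in>{1..m}. \<forall>j\<in>{1..m}. i < j \<longrightarrow> (\<forall>p\<in>r ` F i. \<forall>q\<in>r ` F j. p < q)"
    proof (intro ballI impI)
      fix i j p q assume "i \<in> {1..m}" "j \<in> {1..m}" "i < j" "p \<in> r ` F i" "q \<in> r ` F j"
      then obtain p' q' where "p = r p'" "q = r q'" "p' < q'" using succ.hyps by blast
      thus "p < q" using assms by (simp add: strict_mono_less)
    qed
  qed (use succ.hyps succ.IH in auto)
  thus ?case by (simp add: image_UN)
next
  case (limit \<xi> n F)
  show ?case
  proof (rule schreier_graph.limit[OF limit.hyps(1,2) limit.IH])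
    show "\<forall>p\<in>r ` F. n \<le> p"
    proof
      fix p assume "p \<in> r ` F"
      then obtain q where "p = r q" "n \<le> q" using limit.hyps by blast
      thus "n \<le> p" using strict_mono_imp_increasing[OF assms, of q] by simp
    qed
  qed
qed

lemma schreier_finite: "F \<in> schreier \<phi> \<xi> \<Longrightarrow> finite F"
  and schreier_subset: "F \<in> schreier \<phi> \<xi> \<Longrightarrow> G \<subseteq> F \<Longrightarrow> G \<in> schreier \<phi> \<xi>"
  and schreier_spread: "F \<in> schreier \<phi> \<xi> \<Longrightarrow> strict_mono (r :: nat \<Rightarrow> nat) \<Longrightarrow> r ` F \<in> schreier \<phi> \<xi>"
  using schreier_graph_finite schreier_graph_subset schreier_graph_spread
  unfolding schreier_def by blast+

lemma fundamental_sequencesD: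
  assumes "fundamental_sequences \<phi>" "is_limit \<xi>" "n \<ge> 1"
  shows "\<phi> \<xi> n < \<xi>"
  using assms unfolding fundamental_sequences_def by blast

lemma empty_in_schreier:
  assumes "fundamental_sequences \<phi>"
  shows "{} \<in> schreier \<phi> \<xi>"
proof (induction \<xi> rule: cord_induct)
  case zero
  show ?case by (simp add: schreier_zero)
next
  case (succ \<xi>)
  have "(\<Union>i\<in>{1..1::nat}. {}) \<in> schreier \<phi> (succ \<xi>)"
    using schreier_graph.succ[of 1 \<xi> "\<lambda>_. {}" \<phi>] succ unfolding schreier_def by simp
  thus ?case by simp
next
  case (limit \<xi>)
  have "{} \<in> schreier \<phi> (\<phi> \<xi> 1)"
    using limit(2) fundamental_sequencesD[OF assms limit(1)] by blast
  thus ?case unfolding schreier_limit[OF limit(1)] by blast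
qed

text \<open>Increasing lists turn initial segments of sets into prefixes.\<close>

definition schreier_lists :: "(cord \<Rightarrow> nat \<Rightarrow> cord) \<Rightarrow> cord \<Rightarrow> nat list set" where
  "schreier_lists \<phi> \<xi> = {s. sorted_wrt (<) s \<and> set s \<in> schreier \<phi> \<xi>}"

lemma prefix_closed_schreier_lists: "prefix_closed (schreier_lists \<phi> \<xi>)"
  unfolding prefix_closed_def schreier_lists_def
  by (auto simp: sorted_wrt_append intro: schreier_subset)

lemma schreier_lists_map:
  assumes "strict_mono r" "s \<in> schreier_lists \<phi> \<xi>"
  shows "map r s \<in> schreier_lists \<phi> \<xi>"
  using assms schreier_spread[of "set s" \<phi> \<xi> r] strict_monoD[OF assms(1)]
  unfolding schreier_lists_def by (auto simp: sorted_wrt_map intro: sorted_wrt_mono_rel[rotated])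

lemma sorted_list_in_schreier_lists:
  "F \<in> schreier \<phi> \<xi> \<Longrightarrow> sorted_list_of_set F \<in> schreier_lists \<phi> \<xi>"
  using schreier_finite[of F \<phi> \<xi>] by (simp add: schreier_lists_def)

section \<open>Covering Schreier families by families of smaller rank\<close>

fun conc_pow :: "'a list set \<Rightarrow> nat \<Rightarrow> 'a list set" where
  "conc_pow A 0 = {[]}"
| "conc_pow A (Suc n) = conc A (conc_pow A n)"

lemma Nil_in_conc_pow: "[] \<in> A \<Longrightarrow> [] \<in> conc_pow A n"
  by (induction n) (auto simp: conc_def)

lemma prefix_closed_conc_pow: "prefix_closed A \<Longrightarrow> [] \<in> A \<Longrightarrow> prefix_closed (conc_pow A n)"
  by (induction n) (auto simp: Nil_in_conc_pow intro!: prefix_closed_conc, simp add: prefix_closed_def)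

lemma ranked_conc_pow:
  assumes "ranked A \<alpha>" "prefix_closed A" "[] \<in> A"
  shows "ranked (conc_pow A n) (\<alpha> * ord_of_nat n)"
proof (induction n)
  case 0
  show ?case by (simp add: ranked_def rank_fun_def)
next
  case (Suc n)
  thus ?case using assms by (simp add: ranked_conc prefix_closed_conc_pow)
qed

lemma conc_pow_map:
  assumes "\<And>s. s \<in> A \<Longrightarrow> map r s \<in> A"
  shows "s \<in> conc_pow A n \<Longrightarrow> map r s \<in> conc_pow A n"
proof (induction n arbitrary: s)
  case (Suc n)
  then obtain a b where "s = a @ b" "a \<in> A" "b \<in> conc_pow A n" by (auto simp: conc_def)
  thus ?case using Suc.IH assms by (auto simp: conc_def)
qed simp

lemma sorted_list_of_set_Un:
  fixes A B :: "'a::linorder set"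
  assumes "finite A" "finite B" "\<And>a b. a \<in> A \<Longrightarrow> b \<in> B \<Longrightarrow> a < b"
  shows "sorted_list_of_set (A \<union> B) = sorted_list_of_set A @ sorted_list_of_set B"
proof (rule sorted_distinct_set_unique)
  show "sorted (sorted_list_of_set A @ sorted_list_of_set B)"
    using assms by (auto simp: sorted_append intro: less_imp_le)
  show "distinct (sorted_list_of_set A @ sorted_list_of_set B)"
    using assms by auto
qed (use assms in auto)

text \<open>The blocks are successive, so listing their union lists one block after the other. The
  induction splits off the first block and shifts the index of the rest.\<close>

lemma sorted_list_of_UN_in_conc_pow:
  fixes F :: "nat \<Rightarrow> 'a::linorder set"
  assumes "\<And>i. i \<in> {1..m} \<Longrightarrow> finite (F i)"
    "\<And>i. i \<in> {1..m} \<Longrightarrow> sorted_list_of_set (F i) \<in> A"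
    "\<And>i j p q. i \<in> {1..m} \<Longrightarrow> j \<in> {1..m} \<Longrightarrow> i < j \<Longrightarrow> p \<in> F i \<Longrightarrow> q \<in> F j \<Longrightarrow> p < q"
  shows "sorted_list_of_set (\<Union>i\<in>{1..m}. F i) \<in> conc_pow A m"
  using assms
proof (induction m arbitrary: F)
  case (Suc m)
  let ?G = "\<Union>i\<in>{1..m}. F (Suc i)"
  have "{1..Suc m} = insert 1 (Suc ` {1..m})"
    by (simp add: atLeastAtMost_insertL image_Suc_atLeastAtMost)
  hence "(\<Union>i\<in>{1..Suc m}. F i) = F 1 \<union> ?G" by (simp only: UN_insert UN_simps image_image)
  moreover have "sorted_list_of_set (F 1 \<union> ?G) = sorted_list_of_set (F 1) @ sorted_list_of_set ?G"
  proof (rule sorted_list_of_set_Un)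
    show "a < b" if "a \<in> F 1" "b \<in> ?G" for a b
      using that Suc.prems(3)[of 1 "Suc _" a b] by auto
  qed (use Suc.prems(1) in auto)
  moreover have "sorted_list_of_set ?G \<in> conc_pow A m"
  proof (rule Suc.IH)
    show "p < q" if "i \<in> {1..m}" "j \<in> {1..m}" "i < j" "p \<in> F (Suc i)" "q \<in> F (Suc j)"
      for i j p q
      using that by (intro Suc.prems(3)[of "Suc i" "Suc j"]) auto
  qed (use Suc.prems(1,2) in auto)
  moreover have "sorted_list_of_set (F 1) \<in> A" using Suc.prems(2) by simp
  ultimately show ?case by (auto simp: conc_def)
qed simp

text \<open>
  The part of \<open>\<S>\<^sub>\<xi>\<close> that starts at \<open>k\<close> is covered by \<open>B 1, \<dots>, B k\<close>, each of which has rank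
  strictly below \<open>\<omega>\<^sup>\<xi>\<close>, although \<open>\<S>\<^sub>\<xi>\<close> itself has rank \<open>\<omega>\<^sup>\<xi>\<close>.
\<close>

definition exhausts_schreier :: "(cord \<Rightarrow> nat \<Rightarrow> cord) \<Rightarrow> cord \<Rightarrow> (nat \<Rightarrow> nat list set) \<Rightarrow> bool" where
  "exhausts_schreier \<phi> \<xi> B \<longleftrightarrow>
     (\<forall>n. prefix_closed (B n) \<and> (\<exists>\<beta><omega_pow \<xi>. ranked (B n) \<beta>)) \<and>
     (\<forall>n r s. strict_mono r \<longrightarrow> s \<in> B n \<longrightarrow> map r s \<in> B n) \<and>
     (\<forall>F\<in>schreier \<phi> \<xi>. F \<noteq> {} \<longrightarrow> (\<exists>n\<ge>1. (\<forall>p\<in>F. n \<le> p) \<and> sorted_list_of_set F \<in> B n))"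

text \<open>For sets with minimum \<open>k\<close> only \<open>B n\<close> with
  \<open>n \<le> k\<close> matter. This is a finite union, whose rank bound does not depend on
  \<open>k\<close>, and the different heads are then combined.\<close>

lemma ranked_schreier_lists_if_exhausts:
  assumes "exhausts_schreier \<phi> \<xi> B"
  shows "ranked (schreier_lists \<phi> \<xi>) (omega_pow \<xi>)"
proof (rule ranked_if_ranked_hd)
  fix k
  have B: "ranked (B n) (omega_pow \<xi>)" "prefix_closed (B n)" for n
    using assms unfolding exhausts_schreier_def by (meson less_imp_le order_refl ranked_mono)+
  have "{s \<in> schreier_lists \<phi> \<xi>. s \<noteq> [] \<and> hd s = k} \<subseteq> (\<Union>n\<in>{..k}. B n)"
  proof safe
    fix s assume s: "s \<in> schreier_lists \<phi> \<xi>" "s \<noteq> []" "k = hd s"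
    then obtain n where n: "\<forall>p\<in>set s. n \<le> p" "sorted_list_of_set (set s) \<in> B n"
      using assms unfolding exhausts_schreier_def schreier_lists_def by auto
    have "sorted_list_of_set (set s) = s"
      using s(1) by (simp add: schreier_lists_def strict_sorted_equal)
    thus "s \<in> (\<Union>n\<in>{..hd s}. B n)" using n s(2) by auto
  qed
  thus "ranked {s \<in> schreier_lists \<phi> \<xi>. s \<noteq> [] \<and> hd s = k} (omega_pow \<xi>)"
    using ranked_UN[of "{..k}" B, OF _ B] by (auto intro: ranked_mono)
qed

lemma Nil_in_schreier_lists:
  "fundamental_sequences \<phi> \<Longrightarrow> [] \<in> schreier_lists \<phi> \<xi>"
  by (simp add: schreier_lists_def empty_in_schreier)

text \<open>A set in the successor family consists of some \<open>m\<close> successive blocks with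
  \<open>m\<close> at most its minimum, and \<open>m\<close>-fold concatenations have rank at most
  \<open>omega_pow \<xi> * ord_of_nat m\<close>.\<close>

lemma exhausts_schreier_succ:
  assumes "fundamental_sequences \<phi>" "ranked (schreier_lists \<phi> \<xi>) (omega_pow \<xi>)"
  shows "exhausts_schreier \<phi> (succ \<xi>) (conc_pow (schreier_lists \<phi> \<xi>))"
  unfolding exhausts_schreier_def
proof (intro conjI allI ballI impI)
  show "prefix_closed (conc_pow (schreier_lists \<phi> \<xi>) n)" for n
    by (simp add: prefix_closed_conc_pow prefix_closed_schreier_lists Nil_in_schreier_lists assms(1))
  show "\<exists>\<beta><omega_pow (succ \<xi>). ranked (conc_pow (schreier_lists \<phi> \<xi>) n) \<beta>" for n
    using ranked_conc_pow[OF assms(2) prefix_closed_schreier_lists Nil_in_schreier_lists[OF assms(1)]]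
      times_ord_of_nat_less[OF omega_pow_pos] unfolding omega_pow_succ by blast
  show "map r s \<in> conc_pow (schreier_lists \<phi> \<xi>) n"
    if "strict_mono r" "s \<in> conc_pow (schreier_lists \<phi> \<xi>) n" for n r s
    using conc_pow_map[OF schreier_lists_map[OF that(1)] that(2)] .
  fix G assume "G \<in> schreier \<phi> (succ \<xi>)" "G \<noteq> {}"
  then obtain m F where m: "m \<ge> 1" and G: "G = (\<Union>i\<in>{1..m::nat}. F i)"
    and F: "\<forall>i\<in>{1..m}. F i \<in> schreier \<phi> \<xi>" "\<forall>i\<in>{1..m}. \<forall>p\<in>F i. m \<le> p"
      "\<forall>i\<in>{1..m}. \<forall>j\<in>{1..m}. i < j \<longrightarrow> (\<forall>p\<in>F i. \<forall>q\<in>F j. p < q)"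
    unfolding schreier_succ by blast
  have "sorted_list_of_set G \<in> conc_pow (schreier_lists \<phi> \<xi>) m"
    unfolding G
    by (rule sorted_list_of_UN_in_conc_pow)
       (use F schreier_finite sorted_list_in_schreier_lists in \<open>blast+\<close>)
  thus "\<exists>n\<ge>1. (\<forall>p\<in>G. n \<le> p) \<and> sorted_list_of_set G \<in> conc_pow (schreier_lists \<phi> \<xi>) n"
    using m F(2) G by blast
qed

text \<open>The terms of the fundamental sequence supply the covering. The index is
  \<open>max 1 n\<close> because nothing is known about \<open>\<phi> \<xi> 0\<close>.\<close>

lemma exhausts_schreier_limit:
  assumes "fundamental_sequences \<phi>" "is_limit \<xi>"
    "\<And>\<eta>. \<eta> < \<xi> \<Longrightarrow> ranked (schreier_lists \<phi> \<eta>) (omega_pow \<eta>)"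
  shows "exhausts_schreier \<phi> \<xi> (\<lambda>n. schreier_lists \<phi> (\<phi> \<xi> (max 1 n)))"
  unfolding exhausts_schreier_def
proof (intro conjI allI ballI impI)
  show "\<exists>\<beta><omega_pow \<xi>. ranked (schreier_lists \<phi> (\<phi> \<xi> (max 1 n))) \<beta>" for n
    using fundamental_sequencesD[OF assms(1,2), of "max 1 n"] assms(3) omega_pow_less_limit[OF assms(2)]
    by auto
  fix F assume "F \<in> schreier \<phi> \<xi>" "F \<noteq> {}"
  then obtain n where "n \<ge> 1" "F \<in> schreier \<phi> (\<phi> \<xi> n)" "\<forall>p\<in>F. n \<le> p"
    unfolding schreier_limit[OF assms(2)] by blast
  moreover from this have "max 1 n = n" by simp
  ultimately show "\<exists>n\<ge>1. (\<forall>p\<in>F. n \<le> p) \<and>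
      sorted_list_of_set F \<in> schreier_lists \<phi> (\<phi> \<xi> (max 1 n))"
    using sorted_list_in_schreier_lists by metis
qed (simp_all add: prefix_closed_schreier_lists schreier_lists_map)

text \<open>The bounds at smaller ordinals give an exhausting sequence at \<xi>, which in turn gives
  the bound at \<xi>.\<close>

lemma ranked_schreier_lists:
  assumes "fundamental_sequences \<phi>"
  shows "ranked (schreier_lists \<phi> \<xi>) (omega_pow \<xi>)"
proof (induction \<xi> rule: cord_induct)
  case zero
  have "length s \<le> 1" if "s \<in> schreier_lists \<phi> 0" for s
  proof -
    have "distinct s" using that by (auto simp: schreier_lists_def strict_sorted_iff)
    moreover have "card (set s) \<le> 1" using that by (auto simp: schreier_lists_def schreier_zero)
    ultimately show ?thesis by (simp add: distinct_card)
  qed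
  thus ?case
    by (intro rankedI[where \<rho> = "\<lambda>_. 0"]) (fastforce simp: omega_pow_pos)+
next
  case (succ \<xi>)
  thus ?case using ranked_schreier_lists_if_exhausts exhausts_schreier_succ assms by blast
next
  case (limit \<xi>)
  thus ?case using ranked_schreier_lists_if_exhausts exhausts_schreier_limit assms by blast
qed

lemma ex_exhausts_schreier:
  assumes "fundamental_sequences \<phi>" "\<xi> \<noteq> 0"
  shows "\<exists>B. exhausts_schreier \<phi> \<xi> B"
  using assms exhausts_schreier_succ exhausts_schreier_limit ranked_schreier_lists
  by (metis cord_cases)

section \<open>A dichotomy for prefix-closed families\<close>

text \<open>A fusion argument: at stage \<open>k\<close> the minimum of the current set becomes
  \<open>r k\<close>, and the rest is refined to satisfy \<open>Q\<close>. Later values of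
  \<open>r\<close> stay in the refinement, and \<open>Q\<close> passes to subsets.\<close>

lemma diagonal_subset:
  fixes Q :: "nat \<Rightarrow> nat \<Rightarrow> nat set \<Rightarrow> bool"
  assumes "infinite M"
    and step: "\<And>k n N. infinite N \<Longrightarrow> N \<subseteq> M \<Longrightarrow> \<exists>L\<subseteq>N. infinite L \<and> Q k n L"
    and anti: "\<And>k n L L'. Q k n L \<Longrightarrow> L' \<subseteq> L \<Longrightarrow> Q k n L'"
  shows "\<exists>r. strict_mono r \<and> range r \<subseteq> M \<and> (\<forall>k. Q k (r k) (r ` {k<..}))"
proof -
  let ?m = "\<lambda>N. LEAST n :: nat. n \<in> N"
  \<comment> \<open>The refinement is taken strictly above the minimum, which makes the successive
    minima increase.\<close>
  have "\<forall>k N. \<exists>L. infinite N \<longrightarrow> N \<subseteq> M \<longrightarrow> L \<subseteq> N \<inter> {?m N<..} \<and> infinite L \<and> Q k (?m N) L"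
  proof (intro allI)
    fix k N
    show "\<exists>L. infinite N \<longrightarrow> N \<subseteq> M \<longrightarrow> L \<subseteq> N \<inter> {?m N<..} \<and> infinite L \<and> Q k (?m N) L"
    proof (cases "infinite N \<and> N \<subseteq> M")
      case True
      hence "infinite (N \<inter> {?m N<..})"
        using Diff_infinite_finite[of "{..?m N}" N] by (simp add: Diff_eq Compl_atMost)
      thus ?thesis using step[of "N \<inter> {?m N<..}" k "?m N"] True by blast
    qed blast
  qed
  then obtain G where G: "\<And>k N. infinite N \<Longrightarrow> N \<subseteq> M \<Longrightarrow>
      G k N \<subseteq> N \<inter> {?m N<..} \<and> infinite (G k N) \<and> Q k (?m N) (G k N)"
    by metis
  define S where "S = rec_nat M G"
  have S_Suc: "S (Suc k) = G k (S k)" for k by (simp add: S_def)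
  have S: "infinite (S k) \<and> S k \<subseteq> M" for k
  proof (induction k)
    case (Suc k)
    thus ?case using G[of "S k" k] unfolding S_Suc by blast
  qed (simp add: S_def assms(1))
  define r where "r k = ?m (S k)" for k
  have step: "S (Suc k) \<subseteq> S k \<inter> {r k<..}" "Q k (r k) (S (Suc k))" for k
    using G[of "S k" k] S[of k] by (auto simp: S_Suc r_def)
  have r: "r k \<in> S k" for k
  proof -
    obtain n where "n \<in> S k" using S[of k] infinite_imp_nonempty by blast
    thus ?thesis unfolding r_def by (rule LeastI)
  qed
  have anti_S: "S l \<subseteq> S k" if "k \<le> l" for k l
    by (rule lift_Suc_antimono_le[of S]) (use step that in auto)
  have "strict_mono r"
    using step(1) r by (intro strict_monoI_Suc) blast
  moreover have "r ` {k<..} \<subseteq> S (Suc k)" for k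
  proof
    fix x assume "x \<in> r ` {k<..}"
    then obtain l where "x = r l" "Suc k \<le> l" by (auto simp: Suc_le_eq)
    thus "x \<in> S (Suc k)" using r[of l] anti_S[of "Suc k" l] by blast
  qed
  hence "Q k (r k) (r ` {k<..})" for k using step(2) anti by blast
  moreover have "range r \<subseteq> M" using r S by blast
  ultimately show ?thesis by blast
qed

text \<open>The dichotomy relative to a node \<open>s\<close>, needed for the induction; the root
  \<open>s = []\<close> gives the two inclusions between the families restricted to
  \<open>L\<close>.\<close>

definition dichotomic :: "nat list set \<Rightarrow> nat list set \<Rightarrow> nat list \<Rightarrow> nat set \<Rightarrow> bool" where
  "dichotomic G F s L \<longleftrightarrow>
     (\<forall>t. sorted_wrt (<) t \<longrightarrow> set t \<subseteq> L \<longrightarrow> s @ t \<in> G \<longrightarrow> s @ t \<in> F) \<or>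
     (\<forall>t. sorted_wrt (<) t \<longrightarrow> set t \<subseteq> L \<longrightarrow> s @ t \<in> F \<longrightarrow> s @ t \<in> G)"

text \<open>No extension of \<open>s\<close> belongs to a family that omits \<open>s\<close>, so one
  of the inclusions is vacuous.\<close>

lemma dichotomic_if_notin:
  assumes "prefix_closed G" "prefix_closed F" "s \<notin> G \<or> s \<notin> F"
  shows "dichotomic G F s L"
  using assms unfolding dichotomic_def prefix_closed_def by blast

text \<open>Diagonalise over the children \<open>s @ [n]\<close>. Infinitely many of the chosen
  children take the same alternative, and keeping only those gives this alternative at
  \<open>s\<close>.\<close>

lemma ex_dichotomic_step:
  assumes "prefix_closed G" "prefix_closed F" "infinite M"
    and ext: "\<And>n N. infinite N \<Longrightarrow> \<exists>L\<subseteq>N. infinite L \<and> dichotomic G F (s @ [n]) L"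
  shows "\<exists>L\<subseteq>M. infinite L \<and> dichotomic G F s L"
proof (cases "s \<in> G \<and> s \<in> F")
  case False
  thus ?thesis using dichotomic_if_notin assms by blast
next
  case True
  define P where "P H K n L \<longleftrightarrow> (\<forall>t. sorted_wrt (<) t \<longrightarrow> set t \<subseteq> L \<longrightarrow>
      (s @ [n]) @ t \<in> H \<longrightarrow> (s @ [n]) @ t \<in> K)" for H K n L
  have P_Un: "dichotomic G F (s @ [n]) L \<longleftrightarrow> P G F n L \<or> P F G n L" for n L
    by (simp add: dichotomic_def P_def)
  have "\<exists>r :: nat \<Rightarrow> nat. strict_mono r \<and> range r \<subseteq> M \<and> (\<forall>k. dichotomic G F (s @ [r k]) (r ` {k<..}))"
  proof (rule diagonal_subset[where Q = "\<lambda>_ n. dichotomic G F (s @ [n])", OF assms(3)])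
    show "dichotomic G F (s @ [n]) L'" if "dichotomic G F (s @ [n]) L" "L' \<subseteq> L" for n L L'
      using that subset_trans[of _ L' L] unfolding dichotomic_def by blast
  qed (use ext in blast)
  then obtain r :: "nat \<Rightarrow> nat" where r: "strict_mono r" "range r \<subseteq> M"
    and dich: "\<And>k. P G F (r k) (r ` {k<..}) \<or> P F G (r k) (r ` {k<..})"
    unfolding P_Un by blast
  \<comment> \<open>The first entry of \<open>t\<close> is \<open>r k\<close> for some
    \<open>k\<close> in \<open>I\<close>, and the others come later along \<open>r\<close>, so the
    inclusion at that child applies. For empty \<open>t\<close> membership of \<open>s\<close>
    itself is used.\<close>
  have inherit: "s @ t \<in> K" if hyp: "s \<in> K" "\<And>k. k \<in> I \<Longrightarrow> P H K (r k) (r ` {k<..})"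
    "sorted_wrt (<) t" "set t \<subseteq> r ` I" "s @ t \<in> H" for H K I t
  proof (cases t)
    case (Cons n u)
    then obtain k where k: "k \<in> I" "n = r k" using hyp(4) by auto
    have "set u \<subseteq> r ` {k<..}"
    proof
      fix x assume x: "x \<in> set u"
      then obtain l where l: "x = r l" using hyp(4) Cons by auto
      hence "r k < r l" using hyp(3) Cons k(2) x by auto
      thus "x \<in> r ` {k<..}" using l r(1) by (simp add: strict_mono_less)
    qed
    thus ?thesis using hyp(2)[OF k(1)] hyp(3,5) Cons k(2) unfolding P_def by auto
  qed (use hyp(1) in simp)
  have inf: "infinite {k. P G F (r k) (r ` {k<..})} \<or> infinite {k. P F G (r k) (r ` {k<..})}"
  proof (rule ccontr)
    assume "\<not> ?thesis"
    hence "finite ({k. P G F (r k) (r ` {k<..})} \<union> {k. P F G (r k) (r ` {k<..})})" by simp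
    moreover have "{k. P G F (r k) (r ` {k<..})} \<union> {k. P F G (r k) (r ` {k<..})} = UNIV"
      using dich by blast
    ultimately show False by simp
  qed
  have subset: ?thesis if "infinite I" "dichotomic G F s (r ` I)" for I
  proof (intro exI conjI)
    show "r ` I \<subseteq> M" using r(2) by auto
    show "infinite (r ` I)"
      using that(1) r(1) by (simp add: finite_image_iff strict_mono_imp_inj_on)
  qed (rule that(2))
  have GF: "dichotomic G F s (r ` {k. P G F (r k) (r ` {k<..})})"
    unfolding dichotomic_def using inherit[of F "{k. P G F (r k) (r ` {k<..})}" G] True by blast
  have FG: "dichotomic G F s (r ` {k. P F G (r k) (r ` {k<..})})"
    unfolding dichotomic_def using inherit[of G "{k. P F G (r k) (r ` {k<..})}" F] True by blast
  show ?thesis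
    using inf by (rule disjE) (erule subset[OF _ GF], erule subset[OF _ FG])
qed

text \<open>Induction on the rank of the node in \<open>G\<close>: a child in \<open>G\<close> has
  smaller rank, a child outside \<open>G\<close> is trivial.\<close>

lemma ex_dichotomic:
  assumes "ranked G \<alpha>" "prefix_closed G" "prefix_closed F" "infinite M"
  shows "\<exists>L\<subseteq>M. infinite L \<and> dichotomic G F [] L"
proof -
  obtain \<rho> where "rank_fun G \<alpha> \<rho>"
    using assms(1) unfolding ranked_def by blast
  note \<rho> = rank_funD[OF this]
  have "\<exists>L\<subseteq>N. infinite L \<and> dichotomic G F s L" if "s \<noteq> []" "infinite N" for s N
    using that
  proof (induction "\<rho> s" arbitrary: s N rule: less_induct)
    case less
    show ?case
    proof (rule ex_dichotomic_step[OF assms(2,3) less.prems(2)])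
      fix n and N :: "nat set" assume N: "infinite N"
      show "\<exists>L\<subseteq>N. infinite L \<and> dichotomic G F (s @ [n]) L"
      proof (cases "s @ [n] \<in> G")
        case True
        show ?thesis by (rule less.hyps) (use \<rho>(1)[OF less.prems(1) True] N in auto)
      next
        case False
        thus ?thesis using dichotomic_if_notin[OF assms(2,3)] N by blast
      qed
    qed
  qed
  \<comment> \<open>The root has no rank and takes one further step.\<close>
  thus ?thesis by (rule ex_dichotomic_step[OF assms(2-4)]) simp_all
qed

section \<open>Schreier families inside large families\<close>

lemma filter_le_append_filter_greater:
  fixes m :: "'a::linorder"
  shows "sorted_wrt (<) s \<Longrightarrow> filter (\<lambda>x. x \<le> m) s @ filter (\<lambda>x. m < x) s = s"
proof (induction s)
  case (Cons x s)
  show ?case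
  proof (cases "x \<le> m")
    case False
    hence "filter (\<lambda>x. x \<le> m) s = []" "filter (\<lambda>x. m < x) s = s"
      using Cons.prems by (auto simp: filter_empty_conv filter_id_conv)
    thus ?thesis using False by simp
  qed (use Cons in auto)
qed simp

text \<open>The rank counts the elements that can still be appended.\<close>

lemma ranked_finite:
  fixes X :: "'a::linorder set"
  assumes "finite X"
  shows "ranked {s. sorted_wrt (<) s \<and> set s \<subseteq> X} (ord_of_nat (card X))"
proof (rule rankedI[where \<rho> = "\<lambda>s. ord_of_nat (card X - length s)"])
  have len: "length s \<le> card X" if "sorted_wrt (<) s" "set s \<subseteq> X" for s
    using that assms by (metis card_mono distinct_card strict_sorted_iff)
  show "ord_of_nat (card X - length (s @ [x])) < ord_of_nat (card X - length s)"
    if "s @ [x] \<in> {s. sorted_wrt (<) s \<and> set s \<subseteq> X}" for s x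
    using that len[of "s @ [x]"] by (intro ord_of_nat_strict_mono) simp
  show "ord_of_nat (card X - length s) < ord_of_nat (card X)"
    if "s \<in> {s. sorted_wrt (<) s \<and> set s \<subseteq> X}" "s \<noteq> []" for s
    using that len[of s] by (intro ord_of_nat_strict_mono) (cases s, auto)
qed

lemma sorted_list_of_set_strict_mono_image:
  fixes r :: "nat \<Rightarrow> nat"
  assumes "strict_mono r" "finite F"
  shows "sorted_list_of_set (r ` F) = map r (sorted_list_of_set F)"
proof (rule sorted_distinct_set_unique)
  have "mono r" using assms(1) by (rule strict_mono_mono)
  thus "sorted (map r (sorted_list_of_set F))"
    by (intro sorted_map_mono) (auto intro: monotone_on_subset)
  show "distinct (map r (sorted_list_of_set F))"
    using assms(1) by (simp add: distinct_map strict_mono_imp_inj_on)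
qed (use assms in auto)

text \<open>\<open>C\<close> plays the role of the equivalence constant. Closure under suffixes
  permits cutting off the finite beginning that a diagonal sequence does not control.\<close>

theorem schreier_embeds_in_large_families:
  fixes F :: "nat \<Rightarrow> nat list set"
  assumes "fundamental_sequences \<phi>" "\<xi> \<noteq> 0" "infinite M"
    and pre: "\<And>C. prefix_closed (F C)"
    and suf: "\<And>C s t. s @ t \<in> F C \<Longrightarrow> t \<in> F C"
    and large: "\<And>L. infinite L \<Longrightarrow> L \<subseteq> M \<Longrightarrow>
      \<exists>C. \<forall>\<beta><omega_pow \<xi>. \<not> ranked {s \<in> F C. sorted_wrt (<) s \<and> set s \<subseteq> L} \<beta>"
  shows "\<exists>C r. strict_mono r \<and> range r \<subseteq> M \<and>
    (\<forall>H\<in>schreier \<phi> \<xi>. H \<noteq> {} \<longrightarrow> sorted_list_of_set (r ` H) \<in> F C)"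
proof -
  obtain B where B: "exhausts_schreier \<phi> \<xi> B" using ex_exhausts_schreier[OF assms(1,2)] by blast
  define good where "good C n L \<longleftrightarrow> (\<forall>t\<in>B n. sorted_wrt (<) t \<longrightarrow> set t \<subseteq> L \<longrightarrow> t \<in> F C)" for C n L
  define bad where "bad C n L \<longleftrightarrow> (\<forall>t\<in>F C. sorted_wrt (<) t \<longrightarrow> set t \<subseteq> L \<longrightarrow> t \<in> B n)" for C n L
  have good_subset: "good C n L'" if "good C n L" "L' \<subseteq> L" for C n L L'
    using that(1) subset_trans[OF _ that(2)] unfolding good_def by simp
  have bad_subset: "bad C n L'" if "bad C n L" "L' \<subseteq> L" for C n L L'
    using that(1) subset_trans[OF _ that(2)] unfolding bad_def by simp
  have dich: "\<exists>L'\<subseteq>L. infinite L' \<and> (good C n L' \<or> bad C n L')" if L: "infinite L" for C n L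
  proof -
    obtain \<beta> where "ranked (B n) \<beta>" "prefix_closed (B n)"
      using B unfolding exhausts_schreier_def by blast
    thus ?thesis
      using ex_dichotomic[of "B n" \<beta> "F C", OF _ _ pre L]
      unfolding dichotomic_def good_def bad_def by simp blast
  qed
  \<comment> \<open>One \<open>C\<close> and one \<open>N\<close> below which the good alternative
    is reachable for every \<open>n\<close>. If there were none, then for each \<open>C\<close>
    every infinite subset of \<open>M\<close> would have a bad infinite subset.\<close>
  have "\<exists>C N. N \<subseteq> M \<and> infinite N \<and>
    (\<forall>L n. L \<subseteq> N \<longrightarrow> infinite L \<longrightarrow> (\<exists>L'\<subseteq>L. infinite L' \<and> good C n L'))"
  proof (rule ccontr)
    assume neg: "\<not> ?thesis"
    have step: "\<exists>L\<subseteq>N. infinite L \<and> (\<exists>n. bad C n L)" if N: "infinite N" "N \<subseteq> M" for N C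
    proof -
      have "\<not> (\<forall>L n. L \<subseteq> N \<longrightarrow> infinite L \<longrightarrow> (\<exists>L'\<subseteq>L. infinite L' \<and> good C n L'))"
        by (rule notI, rule notE[OF neg], intro exI conjI) (rule N, rule N)
      then obtain L n where L: "L \<subseteq> N" "infinite L"
        and not_good: "\<not> (\<exists>L'\<subseteq>L. infinite L' \<and> good C n L')"
        by auto
      obtain L' where L': "L' \<subseteq> L" "infinite L'" "good C n L' \<or> bad C n L'"
        using dich[OF L(2), where C = C and n = n] by auto
      hence "bad C n L'" using not_good by auto
      thus ?thesis using L(1) L'(1,2) by (metis subset_trans)
    qed
    have "\<exists>r. strict_mono r \<and> range r \<subseteq> M \<and> (\<forall>C. \<exists>n. bad C n (r ` {C<..}))"
    proof (rule diagonal_subset[where Q = "\<lambda>C _ L. \<exists>n. bad C n L", OF assms(3)])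
      show "\<exists>n. bad C n L'" if "\<exists>n. bad C n L" "L' \<subseteq> L" for C L L'
        using that(1) by (elim exE) (rule exI, erule bad_subset, rule that(2))
    qed (rule step)
    then obtain r where r: "strict_mono r" "range r \<subseteq> M" "\<And>C. \<exists>n. bad C n (r ` {C<..})"
      by blast
    have "infinite (range r)" using r(1) by (simp add: range_inj_infinite strict_mono_imp_inj_on)
    then obtain C where
      C: "\<And>\<beta>. \<beta> < omega_pow \<xi> \<Longrightarrow> \<not> ranked {s \<in> F C. sorted_wrt (<) s \<and> set s \<subseteq> range r} \<beta>"
      using large r(2) by blast
    obtain n where n: "bad C n (r ` {C<..})" using r(3) by blast
    obtain \<beta> where \<beta>: "\<beta> < omega_pow \<xi>" "ranked (B n) \<beta>" "prefix_closed (B n)"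
      using B unfolding exhausts_schreier_def by blast
    \<comment> \<open>Beyond \<open>r C\<close> the lists of \<open>F C\<close> lie in
      \<open>B n\<close>; \<open>K\<close> accounts for the finitely many earlier values and adds
      only a finite ordinal to the rank.\<close>
    define K where "K = {s. sorted_wrt (<) s \<and> set s \<subseteq> r ` {..C}}"
    have "prefix_closed K" unfolding K_def prefix_closed_def by (auto simp: sorted_wrt_append)
    moreover have "ranked K (ord_of_nat (card (r ` {..C})))"
      unfolding K_def by (rule ranked_finite) simp
    ultimately have "ranked (conc K (B n)) (\<beta> + ord_of_nat (card (r ` {..C})))"
      using ranked_conc \<beta> by blast
    moreover have "{s \<in> F C. sorted_wrt (<) s \<and> set s \<subseteq> range r} \<subseteq> conc K (B n)"
    proof safe
      fix s assume s: "s \<in> F C" "sorted_wrt (<) s" "set s \<subseteq> range r"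
      define a where "a = filter (\<lambda>x. x \<le> r C) s"
      define b where "b = filter (\<lambda>x. r C < x) s"
      have ab: "a @ b = s" using filter_le_append_filter_greater[OF s(2)] by (simp add: a_def b_def)
      have "r k \<le> r C \<longleftrightarrow> k \<le> C" "r C < r k \<longleftrightarrow> C < k" for k
        using r(1) by (simp_all add: strict_mono_less strict_mono_less_eq)
      hence sets: "set a \<subseteq> r ` {..C}" "set b \<subseteq> r ` {C<..}"
        using s(3) by (auto simp: a_def b_def)
      have sorted: "sorted_wrt (<) a" "sorted_wrt (<) b"
        using s(2) by (simp_all add: a_def b_def sorted_wrt_filter)
      have "b \<in> F C" using suf[of a b C] ab s(1) by simp
      hence "b \<in> B n" using n sets(2) sorted(2) unfolding bad_def by simp
      moreover have "a \<in> K" using sets(1) sorted(1) by (simp add: K_def)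
      ultimately show "s \<in> conc K (B n)"
        unfolding conc_def using ab[symmetric] by blast
    qed
    ultimately show False
      using C plus_ord_of_nat_less_omega_pow[OF assms(2) \<beta>(1)] ranked_mono by blast
  qed
  then obtain C N where N: "N \<subseteq> M" "infinite N"
    and N_good: "\<forall>L n. L \<subseteq> N \<longrightarrow> infinite L \<longrightarrow> (\<exists>L'\<subseteq>L. infinite L' \<and> good C n L')"
    by (elim exE conjE)
  \<comment> \<open>The index is \<open>Suc k\<close> since the covering families are counted from
    1: if all elements of \<open>H\<close> are at least \<open>n\<close>, then \<open>r\<close>
    sends them to values beyond position \<open>n - 1\<close>, where \<open>good C n\<close>
    holds.\<close>
  have "\<exists>r. strict_mono r \<and> range r \<subseteq> N \<and> (\<forall>k. good C (Suc k) (r ` {k<..}))"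
  proof (rule diagonal_subset[where Q = "\<lambda>k _. good C (Suc k)", OF N(2)])
    show "good C (Suc k) L'" if "good C (Suc k) L" "L' \<subseteq> L" for k L L'
      using that by (rule good_subset)
  qed (use N_good in simp)
  then obtain r where r: "strict_mono r" "range r \<subseteq> N" "\<And>k. good C (Suc k) (r ` {k<..})"
    by blast
  have "sorted_list_of_set (r ` H) \<in> F C" if H: "H \<in> schreier \<phi> \<xi>" "H \<noteq> {}" for H
  proof -
    obtain n where n: "n \<ge> 1" "\<forall>p\<in>H. n \<le> p" "sorted_list_of_set H \<in> B n"
      using B H unfolding exhausts_schreier_def by blast
    have fin: "finite H" using H(1) by (rule schreier_finite)
    \<comment> \<open>Closure of \<open>B n\<close> under spreading.\<close>
    have "sorted_list_of_set (r ` H) \<in> B n"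
      using B n(3) r(1) sorted_list_of_set_strict_mono_image[OF r(1) fin]
      unfolding exhausts_schreier_def by simp
    moreover have "set (sorted_list_of_set (r ` H)) \<subseteq> r ` {n - 1<..}"
      using n(1,2) fin by (auto intro!: imageI)
    ultimately show ?thesis using r(3)[of "n - 1"] n(1) unfolding good_def by simp
  qed
  thus ?thesis using r(1,2) N(1) by blast
qed

section \<open>Subsequences of Schauder bases\<close>

locale schauder_basis =
  fixes e :: "nat \<Rightarrow> 'a::banach"
  assumes ex1_expansion: "\<exists>!a. (\<lambda>n. a n *\<^sub>R e n) sums v"
begin

section \<open>Coefficients and partial sums\<close>

definition coeff :: "'a \<Rightarrow> nat \<Rightarrow> real" where
  "coeff v = (THE a. (\<lambda>n. a n *\<^sub>R e n) sums v)"

lemma coeff_sums: "(\<lambda>n. coeff v n *\<^sub>R e n) sums v"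
  unfolding coeff_def by (rule theI'[OF ex1_expansion])

lemma coeff_unique: "(\<lambda>n. a n *\<^sub>R e n) sums v \<Longrightarrow> coeff v = a"
  using ex1_expansion[of v] coeff_sums[of v] by blast

lemma coeff_add: "coeff (u + v) = (\<lambda>n. coeff u n + coeff v n)"
  by (rule coeff_unique) (simp add: scaleR_left_distrib sums_add coeff_sums)

lemma coeff_diff: "coeff (u - v) = (\<lambda>n. coeff u n - coeff v n)"
  by (rule coeff_unique) (simp add: scaleR_left_diff_distrib sums_diff coeff_sums)

lemma coeff_scaleR: "coeff (t *\<^sub>R v) = (\<lambda>n. t * coeff v n)"
  using sums_scaleR_right[OF coeff_sums[of v], of t] by (intro coeff_unique) simp

lemma coeff_basis: "coeff (e m) = (\<lambda>n. if n = m then 1 else 0)"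
proof (rule coeff_unique)
  have "(\<lambda>n. if n = m then e n else 0) sums e m" by (rule sums_single)
  thus "(\<lambda>n. (if n = m then 1 else 0) *\<^sub>R e n) sums e m"
    by (simp add: if_distrib[of "\<lambda>t. t *\<^sub>R _"] cong: if_cong)
qed

lemma inj_basis: "inj e"
proof (rule injI)
  fix m n assume "e m = e n"
  hence "(if m = m then 1 else 0) = (if m = n then 1 else (0 :: real))"
    using coeff_basis[of m] coeff_basis[of n] by metis
  thus "m = n" by (simp split: if_splits)
qed

lemma basis_nonzero: "e n \<noteq> 0"
proof
  assume "e n = 0"
  moreover have "coeff 0 = (\<lambda>_. 0)" by (rule coeff_unique) simp
  ultimately show False using coeff_basis[of n] by (metis zero_neq_one)
qed

definition partial :: "nat \<Rightarrow> 'a \<Rightarrow> 'a" where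
  "partial N v = (\<Sum>n<N. coeff v n *\<^sub>R e n)"

lemma partial_diff: "partial N (u - v) = partial N u - partial N v"
  by (simp add: partial_def coeff_diff scaleR_left_diff_distrib sum_subtractf)

lemma partial_add: "partial N (u + v) = partial N u + partial N v"
  by (simp add: partial_def coeff_add scaleR_left_distrib sum.distrib)

lemma partial_scaleR: "partial N (t *\<^sub>R v) = t *\<^sub>R partial N v"
  by (simp add: partial_def coeff_scaleR scaleR_sum_right)

lemma partial_0: "partial N 0 = 0"
  using partial_scaleR[of N 0 0] by simp

lemma partial_sum: "partial N (\<Sum>j\<in>J. u j) = (\<Sum>j\<in>J. partial N (u j))"
  by (induction J rule: infinite_finite_induct) (simp_all add: partial_0 partial_add)

lemma partial_tendsto: "(\<lambda>N. partial N v) \<longlonglongrightarrow> v"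
  using coeff_sums[of v] by (simp add: sums_def partial_def)

text \<open>\<open>bdd k v\<close> says that \<open>v\<close> has norm at most \<open>k\<close> for the norm \<open>sup\<^sub>N \<parallel>partial N v\<parallel>\<close>.\<close>

definition bdd :: "real \<Rightarrow> 'a \<Rightarrow> bool" where
  "bdd k v \<longleftrightarrow> (\<forall>N. norm (partial N v) \<le> k)"

section \<open>Continuity of the coefficient functionals\<close>

lemma ex_bdd: "\<exists>k::nat. bdd (real k) v"
proof -
  have "Bseq (\<lambda>N. partial N v)"
    using partial_tendsto convergentI by (blast intro: convergent_imp_Bseq)
  then obtain K where "\<forall>N. norm (partial N v) \<le> K" by (rule BseqE)
  moreover obtain k :: nat where "K \<le> real k" using real_arch_simple by blast
  ultimately show ?thesis unfolding bdd_def by (meson order_trans)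
qed

text \<open>Partial sums of a convergent expansion are bounded, so the sets of \<open>bdd\<close>
  vectors for natural \<open>k\<close> cover the space; by Baire's theorem one closure has
  interior.\<close>

lemma ball_subset_closure_bdd: "\<exists>k x \<epsilon>. \<epsilon> > 0 \<and> ball x \<epsilon> \<subseteq> closure {v. bdd k v}"
proof (rule ccontr)
  assume neg: "\<not> ?thesis"
  have "interior (closure {v. bdd k v}) = {}" for k
    using neg by (auto simp: mem_interior)
  hence "Met_TC.mtopology interior_of (\<Union>k::nat. closure {v. bdd (real k) v}) = {}"
    by (intro Met_TC.metric_Baire_category_alt) (auto simp: complete_UNIV)
  moreover have "(\<Union>k::nat. closure {v. bdd (real k) v}) = UNIV"
  proof (rule UNIV_eq_I[symmetric])
    fix v
    obtain k :: nat where "v \<in> {v. bdd (real k) v}" using ex_bdd[of v] by auto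
    thus "v \<in> (\<Union>k::nat. closure {v. bdd (real k) v})"
      using closure_subset[of "{v. bdd (real k) v}"] by blast
  qed
  ultimately show False by simp
qed

text \<open>Differences of approximants near \<open>x + y\<close> and near \<open>x\<close> move the
  ball to the origin at the cost of a factor 2; homogeneity then treats all
  \<open>y\<close>.\<close>

lemma bdd_approx: "\<exists>K. \<forall>y \<delta>. 0 < \<delta> \<longrightarrow> (\<exists>u. bdd (K * norm y) u \<and> norm (y - u) < \<delta>)"
proof -
  obtain k x \<epsilon> where \<epsilon>: "\<epsilon> > 0" "ball x \<epsilon> \<subseteq> closure {v. bdd k v}"
    using ball_subset_closure_bdd by blast
  have small: "\<exists>u. bdd (2 * k) u \<and> norm (y - u) < \<delta>" if y: "norm y < \<epsilon>" and \<delta>: "0 < \<delta>" for y \<delta>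
  proof -
    have "x + y \<in> closure {v. bdd k v}" "x \<in> closure {v. bdd k v}"
      using \<epsilon> y by (auto simp: dist_norm)
    then obtain u w where u: "bdd k u" "dist (x + y) u < \<delta> / 2" and w: "bdd k w" "dist x w < \<delta> / 2"
      using closure_approachableD[OF _ half_gt_zero[OF \<delta>]] by (metis mem_Collect_eq)
    have "norm (y - (u - w)) = norm ((w - x) - (u - (x + y)))" by (simp add: algebra_simps)
    also have "\<dots> \<le> norm (w - x) + norm (u - (x + y))" by (rule norm_triangle_ineq4)
    also have "\<dots> < \<delta>" using u(2) w(2) by (simp add: dist_norm norm_minus_commute)
    finally have "norm (y - (u - w)) < \<delta>" .
    moreover have "norm (partial N u - partial N w) \<le> 2 * k" for N
    proof -
      have "norm (partial N u) \<le> k" "norm (partial N w) \<le> k" using u(1) w(1) by (simp_all add: bdd_def)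
      thus ?thesis using norm_triangle_ineq4[of "partial N u" "partial N w"] by linarith
    qed
    hence "bdd (2 * k) (u - w)" by (simp add: bdd_def partial_diff)
    ultimately show ?thesis by blast
  qed
  have "\<exists>u. bdd (4 * k / \<epsilon> * norm y) u \<and> norm (y - u) < \<delta>" if \<delta>: "0 < \<delta>" for y \<delta>
  proof (cases "y = 0")
    case True
    thus ?thesis using \<delta> by (intro exI[of _ 0]) (simp add: bdd_def partial_0)
  next
    case False
    \<comment> \<open>Rescales \<open>y\<close> to norm \<epsilon>/2; undoing this turns
      \<open>2 * k\<close> into \<open>4 * k / \<epsilon> * norm y\<close>.\<close>
    define t where "t = \<epsilon> / (2 * norm y)"
    have t: "t > 0" using False \<epsilon>(1) by (simp add: t_def)
    have "norm (t *\<^sub>R y) < \<epsilon>" using False \<epsilon>(1) by (simp add: t_def)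
    then obtain u where u: "bdd (2 * k) u" "norm (t *\<^sub>R y - u) < t * \<delta>"
      using small[of "t *\<^sub>R y" "t * \<delta>"] t \<delta> by auto
    have "norm (y - (1 / t) *\<^sub>R u) = norm ((1 / t) *\<^sub>R (t *\<^sub>R y - u))"
      using t by (simp add: scaleR_right_diff_distrib)
    also have "\<dots> = norm (t *\<^sub>R y - u) / t" using t by simp
    also have "\<dots> < \<delta>" using u(2) t by (simp add: field_simps)
    finally have "norm (y - (1 / t) *\<^sub>R u) < \<delta>" .
    moreover have "norm (partial N ((1 / t) *\<^sub>R u)) \<le> 4 * k / \<epsilon> * norm y" for N
    proof -
      have "norm (partial N ((1 / t) *\<^sub>R u)) = norm (partial N u) / t"
        using t by (simp add: partial_scaleR)
      also have "\<dots> \<le> 2 * k / t" using u(1) t by (simp add: bdd_def divide_right_mono)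
      also have "\<dots> = 4 * k / \<epsilon> * norm y" by (simp add: t_def)
      finally show ?thesis .
    qed
    hence "bdd (4 * k / \<epsilon> * norm y) ((1 / t) *\<^sub>R u)" by (simp add: bdd_def)
    ultimately show ?thesis by blast
  qed
  thus ?thesis by (intro exI[of _ "4 * k / \<epsilon>"]) simp
qed

text \<open>
  The iteration from the proof of the open mapping theorem: \<open>v\<close> is a series of vectors that are
  geometrically small for the norm \<open>sup\<^sub>N \<parallel>partial N v\<parallel>\<close>.
\<close>

lemma ex_bdd_series:
  assumes approx: "\<forall>y \<delta>. 0 < \<delta> \<longrightarrow> (\<exists>u. bdd (K * norm y) u \<and> norm (y - u) < \<delta>)" and "v \<noteq> 0"
  shows "\<exists>u. (\<forall>j. bdd (\<bar>K\<bar> * norm v * (1 / 2) ^ j) (u j)) \<and> u sums v"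
proof -
  define U where "U y \<delta> = (SOME u. bdd (K * norm y) u \<and> norm (y - u) < \<delta>)" for y \<delta>
  have U: "bdd (K * norm y) (U y \<delta>) \<and> norm (y - U y \<delta>) < \<delta>" if "0 < \<delta>" for y \<delta>
    unfolding U_def by (rule someI_ex) (use approx that in simp)
  define d where "d j = norm v * (1 / 2) ^ j" for j :: nat
  have d: "d j > 0" for j using assms(2) by (simp add: d_def)
  \<comment> \<open>\<open>Y j\<close> is the remainder after \<open>j\<close> corrections; the
    tolerance \<open>d (Suc j)\<close> forces its norm bound to halve each time.\<close>
  define Y where "Y = rec_nat v (\<lambda>j y. y - U y (d (Suc j)))"
  define u where "u j = U (Y j) (d (Suc j))" for j
  have Y_0: "Y 0 = v" and Y_Suc: "Y (Suc j) = Y j - u j" for j by (simp_all add: Y_def u_def)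
  have Y: "norm (Y j) \<le> d j" for j
  proof (cases j)
    case (Suc i)
    thus ?thesis using U[OF d[of "Suc i"], of "Y i"] by (simp add: Y_Suc u_def)
  qed (simp add: Y_0 d_def)
  have "bdd (\<bar>K\<bar> * norm v * (1 / 2) ^ j) (u j)" for j
  proof -
    \<comment> \<open>The absolute value is taken because the sign of \<open>K\<close> is
      unspecified.\<close>
    have "K * norm (Y j) \<le> \<bar>K\<bar> * d j" using Y[of j] by (intro mult_mono) auto
    thus ?thesis
      using U[OF d[of "Suc j"], of "Y j"] unfolding u_def bdd_def d_def by (metis mult.assoc order_trans)
  qed
  moreover have "u sums v"
  proof -
    have "(\<Sum>j<J. u j) = v - Y J" for J
      by (induction J) (simp_all add: Y_0 Y_Suc)
    moreover have "Y \<longlonglongrightarrow> 0"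
    proof (rule Lim_null_comparison)
      show "\<forall>\<^sub>F j in sequentially. norm (Y j) \<le> d j" using Y by simp
      have "(\<lambda>j. norm v * (1 / 2) ^ j) \<longlonglongrightarrow> norm v * 0"
        by (intro tendsto_intros LIMSEQ_power_zero) simp
      thus "d \<longlonglongrightarrow> 0" by (simp add: d_def[abs_def])
    qed
    hence "(\<lambda>J. v - Y J) \<longlonglongrightarrow> v - 0" by (intro tendsto_intros)
    ultimately show ?thesis by (simp add: sums_def)
  qed
  ultimately show ?thesis by blast
qed

text \<open>Summing the partial sums over \<open>j\<close> gives \<open>P N\<close>, with errors
  uniform in \<open>N\<close>, so \<open>P\<close> tends to \<open>v\<close>. As \<open>P N\<close>
  is the partial sum of a series along \<open>e\<close>, uniqueness of the expansion identifies it
  with \<open>partial N v\<close>.\<close>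

lemma bdd_series:
  assumes u: "\<And>j. bdd (c * (1 / 2) ^ j) (u j)" and v: "u sums v"
  shows "bdd (2 * c) v"
proof -
  have geom: "(\<lambda>j. c * (1 / 2) ^ j) sums (2 * c)"
    using sums_mult[OF geometric_sums[of "1 / 2 :: real"], of c] by (simp add: mult.commute)
  have bound: "norm (partial N (u j)) \<le> c * (1 / 2) ^ j" for N j
    using u unfolding bdd_def by blast
  have summable: "summable (\<lambda>j. partial N (u j))" for N
    by (rule summable_comparison_test'[OF sums_summable[OF geom]]) (rule bound)
  define P where "P N = (\<Sum>j. partial N (u j))" for N
  have tail: "norm (P N - partial N (\<Sum>j<J. u j)) \<le> 2 * c * (1 / 2) ^ J" for N J
  proof -
    have geom': "(\<lambda>j. c * (1 / 2) ^ (j + J)) sums (2 * c * (1 / 2) ^ J)"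
      using sums_mult2[OF geom, of "(1 / 2) ^ J"] by (simp add: power_add mult_ac)
    have "P N - partial N (\<Sum>j<J. u j) = (\<Sum>j. partial N (u (j + J)))"
      using suminf_minus_initial_segment[OF summable, of N J] by (simp add: P_def partial_sum)
    also have "norm \<dots> \<le> 2 * c * (1 / 2) ^ J"
      using bound sums_summable[OF geom'] unfolding sums_unique[OF geom']
      by (intro norm_suminf_le)
    finally show ?thesis .
  qed
  have "P \<longlonglongrightarrow> v"
  proof (rule LIMSEQ_I)
    fix \<epsilon> :: real assume "\<epsilon> > 0"
    have "(\<lambda>J. 2 * c * (1 / 2) ^ J) \<longlonglongrightarrow> 2 * c * 0"
      by (intro tendsto_intros LIMSEQ_power_zero) simp
    hence "\<forall>\<^sub>F J in sequentially. 2 * c * (1 / 2) ^ J < \<epsilon> / 3"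
      by (rule order_tendstoD(2)) (use \<open>\<epsilon> > 0\<close> in simp)
    moreover have "\<forall>\<^sub>F J in sequentially. dist (\<Sum>j<J. u j) v < \<epsilon> / 3"
      using v \<open>\<epsilon> > 0\<close> unfolding sums_def by (intro tendstoD) auto
    ultimately have "\<forall>\<^sub>F J in sequentially. 2 * c * (1 / 2) ^ J < \<epsilon> / 3 \<and> dist (\<Sum>j<J. u j) v < \<epsilon> / 3"
      by (rule eventually_conj)
    then obtain J where J: "2 * c * (1 / 2) ^ J < \<epsilon> / 3" "dist (\<Sum>j<J. u j) v < \<epsilon> / 3"
      by (auto simp: eventually_sequentially)
    let ?w = "\<Sum>j<J. u j"
    obtain N0 where N0: "\<And>N. N \<ge> N0 \<Longrightarrow> norm (partial N ?w - ?w) < \<epsilon> / 3"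
      using LIMSEQ_D[OF partial_tendsto[of ?w], of "\<epsilon> / 3"] \<open>\<epsilon> > 0\<close> by auto
    have "norm (P N - v) < \<epsilon>" if "N \<ge> N0" for N
    proof -
      have "P N - v = (P N - partial N ?w) + (partial N ?w - ?w) + (?w - v)" by simp
      also have "norm \<dots> \<le> norm (P N - partial N ?w) + norm (partial N ?w - ?w) + norm (?w - v)"
        by (meson norm_triangle_ineq norm_triangle_le add_mono order_refl)
      finally show ?thesis using tail[of N J] J N0[OF that] by (simp add: dist_norm)
    qed
    thus "\<exists>N0. \<forall>N\<ge>N0. norm (P N - v) < \<epsilon>" by blast
  qed
  \<comment> \<open>A term of an expansion is the difference of two consecutive partial sums, which
    makes the coefficients summable in \<open>j\<close>.\<close>
  moreover have P: "P N = (\<Sum>n<N. (\<Sum>j. coeff (u j) n) *\<^sub>R e n)" for N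
  proof -
    have "summable (\<lambda>j. coeff (u j) n)" for n
    proof (rule summable_comparison_test')
      show "summable (\<lambda>j. 2 * c / norm (e n) * (1 / 2) ^ j)" by (intro summable_mult summable_geometric) simp
      fix j :: nat
      have "\<bar>coeff (u j) n\<bar> * norm (e n) = norm (partial (Suc n) (u j) - partial n (u j))"
        by (simp add: partial_def)
      also have "\<dots> \<le> c * (1 / 2) ^ j + c * (1 / 2) ^ j"
        using bound norm_triangle_ineq4 add_mono order_trans by meson
      finally show "norm (coeff (u j) n) \<le> 2 * c / norm (e n) * (1 / 2) ^ j"
        using basis_nonzero[of n] by (simp add: field_simps)
    qed
    thus ?thesis
      unfolding P_def partial_def
      by (subst suminf_sum) (auto intro: summable_scaleR_left simp: suminf_scaleR_left)
  qed
  ultimately have "coeff v = (\<lambda>n. \<Sum>j. coeff (u j) n)"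
    unfolding P[abs_def] by (intro coeff_unique) (simp only: sums_def)
  hence "partial N v = P N" for N
    by (simp add: partial_def P)
  \<comment> \<open>At \<open>J = 0\<close> the tail is all of \<open>P N\<close>.\<close>
  thus ?thesis using tail[of _ 0] by (simp add: bdd_def partial_0)
qed

text \<open>The two series lemmas bound all partial sums by a multiple of \<open>norm v\<close>, and
  consecutive partial sums differ by one term.\<close>

lemma bounded_linear_coeff: "bounded_linear (\<lambda>v. coeff v n)"
proof -
  obtain K where approx:
    "\<forall>y \<delta>. 0 < \<delta> \<longrightarrow> (\<exists>u. bdd (K * norm y) u \<and> norm (y - u) < \<delta>)"
    using bdd_approx by (rule exE)
  have bdd: "bdd (2 * (\<bar>K\<bar> * norm v)) v" for v
  proof (cases "v = 0")
    case False
    thus ?thesis using ex_bdd_series[OF approx False] bdd_series by blast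
  qed (simp add: bdd_def partial_0)
  show ?thesis
  proof (rule bounded_linear_intro[where K = "4 * \<bar>K\<bar> / norm (e n)"])
    fix v
    have "\<bar>coeff v n\<bar> * norm (e n) = norm (partial (Suc n) v - partial n v)"
      by (simp add: partial_def)
    also have "\<dots> \<le> 2 * (\<bar>K\<bar> * norm v) + 2 * (\<bar>K\<bar> * norm v)"
      using bdd[of v] norm_triangle_ineq4 add_mono order_trans unfolding bdd_def by meson
    finally show "norm (coeff v n) \<le> norm v * (4 * \<bar>K\<bar> / norm (e n))"
      using basis_nonzero[of n] by (simp add: field_simps)
  qed (simp_all add: coeff_add coeff_scaleR)
qed

text \<open>The kernel of a continuous coefficient functional is a closed subspace.\<close>

lemma coeff_closure_span:
  assumes "v \<in> closure (span (range (e \<circ> r)))" "n \<notin> range r"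
  shows "coeff v n = 0"
proof -
  interpret bounded_linear "\<lambda>v. coeff v n" by (rule bounded_linear_coeff)
  have "closed {v. coeff v n = 0}"
    by (intro closed_Collect_eq continuous_intros continuous_on bounded_linear.continuous_on[OF bounded_linear_coeff])
  moreover have "subspace {v. coeff v n = 0}"
    by (simp add: subspace_def coeff_add coeff_scaleR zero)
  moreover have "range (e \<circ> r) \<subseteq> {v. coeff v n = 0}"
    using assms(2) by (auto simp: coeff_basis)
  ultimately have "closure (span (range (e \<circ> r))) \<subseteq> {v. coeff v n = 0}"
    by (intro closure_minimal span_minimal)
  thus ?thesis using assms(1) by blast
qed

text \<open>Existence: the expansion of \<open>v\<close> along \<open>e\<close> has zero
  coefficients off the subsequence. Uniqueness: an expansion along the subsequence extends by zeros
  to one along \<open>e\<close>.\<close>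

lemma basic_subsequence:
  assumes "strict_mono r"
  shows "basic_sequence (e \<circ> r)"
  unfolding basic_sequence_def schauder_basis_of_def
proof (intro conjI ballI)
  show "range (e \<circ> r) \<subseteq> closure (span (range (e \<circ> r)))"
    using span_superset closure_subset by (rule subset_trans)
  fix v assume v: "v \<in> closure (span (range (e \<circ> r)))"
  show "\<exists>!a. (\<lambda>n. a n *\<^sub>R (e \<circ> r) n) sums v"
  proof (rule ex1I[where a = "\<lambda>n. coeff v (r n)"])
    show "(\<lambda>n. coeff v (r n) *\<^sub>R (e \<circ> r) n) sums v"
      using sums_mono_reindex[OF assms, of "\<lambda>n. coeff v n *\<^sub>R e n" v] coeff_sums[of v]
        coeff_closure_span[OF v] by simp
    fix a assume a: "(\<lambda>n. a n *\<^sub>R (e \<circ> r) n) sums v"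
    have inv: "inv r (r n) = n" for n using assms by (simp add: strict_mono_imp_inj_on)
    define b where "b n = (if n \<in> range r then a (inv r n) else 0)" for n
    have "(\<lambda>n. b n *\<^sub>R e n) sums v"
      using sums_mono_reindex[OF assms, of "\<lambda>n. b n *\<^sub>R e n" v] a by (simp add: b_def inv)
    hence "coeff v = b" by (rule coeff_unique)
    thus "a = (\<lambda>n. coeff v (r n))" by (simp add: b_def inv)
  qed
qed

end

section \<open>Spreading models\<close>

text \<open>Indexing coefficients by entries instead of positions makes the estimates depend only on
  the set of entries.\<close>

lemma equiv_l1_basis_map:
  fixes x :: "'b \<Rightarrow> 'a::real_normed_vector"
  assumes "distinct ns"
  shows "equiv_l1_basis C (map x ns) \<longleftrightarrow>
    (\<forall>a. (1 / C) * (\<Sum>n\<in>set ns. \<bar>a n\<bar>) \<le> norm (\<Sum>n\<in>set ns. a n *\<^sub>R x n) \<and>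
         norm (\<Sum>n\<in>set ns. a n *\<^sub>R x n) \<le> C * (\<Sum>n\<in>set ns. \<bar>a n\<bar>))" (is "_ \<longleftrightarrow> ?R")
proof -
  have bij: "bij_betw ((!) ns) {..<length ns} (set ns)"
    by (rule bij_betw_nth[OF assms]) simp_all
  have sum1: "(\<Sum>n\<in>set ns. \<bar>a n\<bar>) = (\<Sum>i<length ns. \<bar>a (ns ! i)\<bar>)" for a :: "'b \<Rightarrow> real"
    by (rule sum.reindex_bij_betw[OF bij, symmetric])
  have sum2: "(\<Sum>n\<in>set ns. a n *\<^sub>R x n) = (\<Sum>i<length ns. a (ns ! i) *\<^sub>R x (ns ! i))" for a
    by (rule sum.reindex_bij_betw[OF bij, symmetric])
  have inv: "a (inv_into {..<length ns} ((!) ns) (ns ! i)) = a i" if "i < length ns"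
    for i and a :: "nat \<Rightarrow> real"
    using bij that by (simp add: bij_betw_def inv_into_f_f)
  show ?thesis
  proof
    assume *: "equiv_l1_basis C (map x ns)"
    show ?R
    proof
      fix a :: "'b \<Rightarrow> real"
      show "(1 / C) * (\<Sum>n\<in>set ns. \<bar>a n\<bar>) \<le> norm (\<Sum>n\<in>set ns. a n *\<^sub>R x n) \<and>
         norm (\<Sum>n\<in>set ns. a n *\<^sub>R x n) \<le> C * (\<Sum>n\<in>set ns. \<bar>a n\<bar>)"
        using *[unfolded equiv_l1_basis_def, THEN spec[of _ "\<lambda>i. a (ns ! i)"]]
        by (simp add: sum1 sum2)
    qed
  next
    assume R: ?R
    show "equiv_l1_basis C (map x ns)"
      unfolding equiv_l1_basis_def
    proof
      fix a :: "nat \<Rightarrow> real"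
      show "1 / C * (\<Sum>i<length (map x ns). \<bar>a i\<bar>)
            \<le> norm (\<Sum>i<length (map x ns). a i *\<^sub>R map x ns ! i) \<and>
            norm (\<Sum>i<length (map x ns). a i *\<^sub>R map x ns ! i)
            \<le> C * (\<Sum>i<length (map x ns). \<bar>a i\<bar>)"
        using R[THEN spec[of _ "\<lambda>n. a (inv_into {..<length ns} ((!) ns) n)"]]
        by (simp add: sum1 sum2 inv)
    qed
  qed
qed

text \<open>Only the lower estimate is recorded, the upper one being automatic for normalized
  vectors. The constant is natural so that it can be diagonalised over.\<close>

definition l1_family :: "(nat \<Rightarrow> 'a::real_normed_vector) \<Rightarrow> nat \<Rightarrow> nat list set" where
  "l1_family e C =
     {s. \<forall>a. (\<Sum>n\<in>set s. \<bar>a n\<bar>) \<le> real C * norm (\<Sum>n\<in>set s. a n *\<^sub>R e n)}"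

text \<open>Extend the coefficients by zero. This yields closure under prefixes and under
  suffixes.\<close>

lemma l1_family_subset:
  assumes "s \<in> l1_family e C" "set t \<subseteq> set s"
  shows "t \<in> l1_family e C"
  unfolding l1_family_def
proof (rule CollectI, rule allI)
  fix a :: "nat \<Rightarrow> real"
  let ?b = "\<lambda>n. if n \<in> set t then a n else 0"
  have "(\<Sum>n\<in>set s. \<bar>?b n\<bar>) = (\<Sum>n\<in>set t. \<bar>a n\<bar>)"
    "(\<Sum>n\<in>set s. ?b n *\<^sub>R e n) = (\<Sum>n\<in>set t. a n *\<^sub>R e n)"
    using assms(2) by (auto intro!: sum.mono_neutral_cong_right)
  thus "(\<Sum>n\<in>set t. \<bar>a n\<bar>) \<le> real C * norm (\<Sum>n\<in>set t. a n *\<^sub>R e n)"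
    using assms(1)[unfolded l1_family_def, THEN CollectD, THEN spec[of _ ?b]] by simp
qed

lemma l1_family_if_equiv_l1_basis:
  assumes "distinct s" "equiv_l1_basis C (map e s)" "C \<ge> 1"
  shows "s \<in> l1_family e (nat \<lceil>C\<rceil>)"
  unfolding l1_family_def
proof (rule CollectI, rule allI)
  fix a :: "nat \<Rightarrow> real"
  let ?v = "\<Sum>n\<in>set s. a n *\<^sub>R e n"
  have "(1 / C) * (\<Sum>n\<in>set s. \<bar>a n\<bar>) \<le> norm ?v"
    using assms(2) unfolding equiv_l1_basis_map[OF assms(1)] by blast
  hence "(\<Sum>n\<in>set s. \<bar>a n\<bar>) \<le> C * norm ?v" using assms(3) by (simp add: field_simps)
  also have "\<dots> \<le> real (nat \<lceil>C\<rceil>) * norm ?v" by (intro mult_right_mono real_nat_ceiling_ge) simp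
  finally show "(\<Sum>n\<in>set s. \<bar>a n\<bar>) \<le> real (nat \<lceil>C\<rceil>) * norm ?v" .
qed

text \<open>The upper estimate is the triangle inequality; \<open>max 1\<close> covers the
  possibility \<open>C = 0\<close>.\<close>

lemma equiv_l1_basis_if_l1_family:
  assumes "distinct s" "s \<in> l1_family e C" "\<And>n. n \<in> set s \<Longrightarrow> norm (e n) = 1"
  shows "equiv_l1_basis (max 1 (real C)) (map e s)"
  unfolding equiv_l1_basis_map[OF assms(1)]
proof (intro allI conjI)
  fix a :: "nat \<Rightarrow> real"
  let ?v = "\<Sum>n\<in>set s. a n *\<^sub>R e n" and ?C = "max 1 (real C)"
  have "(\<Sum>n\<in>set s. \<bar>a n\<bar>) \<le> real C * norm ?v" using assms(2) by (simp add: l1_family_def)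
  also have "\<dots> \<le> ?C * norm ?v" by (intro mult_right_mono) auto
  finally show "(1 / ?C) * (\<Sum>n\<in>set s. \<bar>a n\<bar>) \<le> norm ?v"
    by (simp add: divide_le_eq mult.commute)
  have "norm ?v \<le> (\<Sum>n\<in>set s. norm (a n *\<^sub>R e n))" by (rule norm_sum)
  also have "\<dots> = (\<Sum>n\<in>set s. \<bar>a n\<bar>)" by (intro sum.cong) (simp_all add: assms(3))
  also have "\<dots> \<le> ?C * (\<Sum>n\<in>set s. \<bar>a n\<bar>)"
    using mult_right_mono[of 1 ?C "\<Sum>n\<in>set s. \<bar>a n\<bar>"] by (simp add: sum_nonneg)
  finally show "norm ?v \<le> ?C * (\<Sum>n\<in>set s. \<bar>a n\<bar>)" .
qed

lemma schreier_graph_pos: "(\<xi>, F) \<in> schreier_graph \<phi> \<Longrightarrow> \<forall>p\<in>F. 1 \<le> p"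
proof (induction \<xi> F rule: schreier_graph.induct)
  case (succ m \<xi> F)
  show ?case
  proof
    fix p assume "p \<in> (\<Union>i\<in>{1..m}. F i)"
    then obtain i where "i \<in> {1..m}" "p \<in> F i" by blast
    thus "1 \<le> p" using succ.IH by blast
  qed
qed simp_all

lemma schreier_pos: "F \<in> schreier \<phi> \<xi> \<Longrightarrow> p \<in> F \<Longrightarrow> 1 \<le> p"
  using schreier_graph_pos unfolding schreier_def by blast

theorem proposition3p7:
  fixes e :: "nat \<Rightarrow> 'a::banach"
    and \<xi> :: cord
    and \<phi> :: "cord \<Rightarrow> nat \<Rightarrow> cord"
  assumes "fundamental_sequences \<phi>"
    and "schauder_basis_of UNIV e"
    and "\<forall>L :: nat set. infinite L \<longrightarrow>
           (\<exists>T. T \<subseteq> {subseq_on e F |F. F \<subseteq> L \<and> finite F} \<and>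
                is_l1_tree T \<and> has_tree_order T (omega_pow \<xi>))"
  shows "\<exists>r. strict_mono r \<and> generates_l1_spreading_model \<phi> \<xi> (e \<circ> r)"
proof -
  interpret schauder_basis e
    using assms(2) by unfold_locales (simp add: schauder_basis_of_def)
  \<comment> \<open>A Schauder basis need not be normalized, so the subsequence is sought inside
    \<open>M\<close>.\<close>
  define M where "M = {n. norm (e n) = 1}"
  have tree: "\<exists>T C. T \<subseteq> {subseq_on e F |F. F \<subseteq> L \<and> finite F} \<and> is_tree T \<and> C \<ge> 1 \<and>
      (\<forall>xs\<in>T. (\<forall>x\<in>set xs. norm x = 1) \<and> equiv_l1_basis C xs) \<and>
      (\<forall>\<beta>. tree_D_iter \<beta> T = {} \<longrightarrow> omega_pow \<xi> \<le> \<beta>)" if L: "infinite L" for L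
  proof -
    obtain T where T: "T \<subseteq> {subseq_on e F |F. F \<subseteq> L \<and> finite F}" "is_l1_tree T"
      "has_tree_order T (omega_pow \<xi>)"
      using assms(3) L by blast
    thus ?thesis unfolding is_l1_tree_def has_tree_order_def by (intro exI[of _ T]) blast
  qed
  \<comment> \<open>Otherwise the complement of \<open>M\<close> would carry a tree of positive
    order, hence a nonempty list of unit vectors with indices outside \<open>M\<close>.\<close>
  have "infinite M"
  proof
    assume "finite M"
    hence "infinite (- M)" by (simp add: finite_compl)
    then obtain T C where T: "T \<subseteq> {subseq_on e F |F. F \<subseteq> - M \<and> finite F}" "is_tree T" "1 \<le> C"
      "\<forall>xs\<in>T. (\<forall>x\<in>set xs. norm x = 1) \<and> equiv_l1_basis C xs"
      "\<forall>\<beta>. tree_D_iter \<beta> T = {} \<longrightarrow> omega_pow \<xi> \<le> \<beta>"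
      by (rule tree[THEN exE]) (elim exE conjE)
    have "T \<noteq> {}" using T(5) omega_pow_pos[of \<xi>] tree_D_iter_zero by (metis not_le)
    then obtain F where F: "subseq_on e F \<in> T" "F \<subseteq> - M" "finite F" using T(1) by blast
    moreover have "F \<noteq> {}" using F(1) T(2) by (auto simp: subseq_on_def is_tree_def)
    ultimately obtain n where "n \<in> F" "n \<notin> M" by blast
    moreover from this have "norm (e n) = 1"
      using T(4) F(1,3) unfolding subseq_on_def by fastforce
    ultimately show False by (simp add: M_def)
  qed
  have "\<exists>C r. strict_mono r \<and> range r \<subseteq> M \<and>
      (\<forall>H\<in>schreier \<phi> \<xi>. H \<noteq> {} \<longrightarrow> sorted_list_of_set (r ` H) \<in> l1_family e C)"
  \<comment> \<open>For \<xi> = 0 there is no covering of smaller rank, but nonempty Schreier sets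
    are singletons and any increasing enumeration of \<open>M\<close> works.\<close>
  proof (cases "\<xi> = 0")
    case True
    have "sorted_list_of_set (enumerate M ` H) \<in> l1_family e 1"
      if H: "H \<in> schreier \<phi> \<xi>" "H \<noteq> {}" for H
    proof -
      obtain n where "H = {n}" using \<open>\<xi> = 0\<close> H by (auto simp: schreier_zero)
      moreover have "norm (e (enumerate M n)) = 1"
        using enumerate_in_set[OF \<open>infinite M\<close>, of n] by (simp add: M_def)
      ultimately show ?thesis by (simp add: l1_family_def)
    qed
    thus ?thesis
      using \<open>infinite M\<close>
      by (intro exI[of _ 1] exI[of _ "enumerate M"]) (simp add: strict_mono_enumerate range_enumerate)
  next
    case False
    have large: "\<exists>C. \<forall>\<beta><omega_pow \<xi>.
        \<not> ranked {s \<in> l1_family e C. sorted_wrt (<) s \<and> set s \<subseteq> L} \<beta>" if L: "infinite L" for L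
    proof -
      obtain T C where T: "T \<subseteq> {subseq_on e F |F. F \<subseteq> L \<and> finite F}" "is_tree T" "1 \<le> C"
        "\<forall>xs\<in>T. (\<forall>x\<in>set xs. norm x = 1) \<and> equiv_l1_basis C xs"
        "\<forall>\<beta>. tree_D_iter \<beta> T = {} \<longrightarrow> omega_pow \<xi> \<le> \<beta>"
        using L by (rule tree[THEN exE]) (elim exE conjE)
      let ?A = "{s \<in> l1_family e (nat \<lceil>C\<rceil>). sorted_wrt (<) s \<and> set s \<subseteq> L}"
      have "T \<subseteq> map e ` ?A"
      proof
        fix xs assume xs: "xs \<in> T"
        then obtain F where F: "xs = map e (sorted_list_of_set F)" "F \<subseteq> L" "finite F"
          using T(1) by (auto simp: subseq_on_def)
        moreover have "equiv_l1_basis C (map e (sorted_list_of_set F))" using T(4) xs F(1) by blast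
        hence "sorted_list_of_set F \<in> l1_family e (nat \<lceil>C\<rceil>)"
          using T(3) by (intro l1_family_if_equiv_l1_basis) simp_all
        ultimately show "xs \<in> map e ` ?A" by simp
      qed
      \<comment> \<open>A rank for the index lists transfers to \<open>T\<close>, so a bound below
        \<open>omega_pow \<xi>\<close> would make a derivative of \<open>T\<close> vanish too
        early.\<close>
      hence "ranked T \<beta>" if "ranked ?A \<beta>" for \<beta>
        using ranked_mono[OF ranked_image_map[OF that inj_basis]] by blast
      hence "\<not> ranked ?A \<beta>" if "\<beta> < omega_pow \<xi>" for \<beta>
        using ranked_tree_D_iter T(2,5) that by (meson not_le)
      thus ?thesis by blast
    qed
    show ?thesis
    proof (rule schreier_embeds_in_large_families[OF assms(1) False \<open>infinite M\<close>])
      show "prefix_closed (l1_family e C)" for C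
        unfolding prefix_closed_def by (auto elim: l1_family_subset)
      show "t \<in> l1_family e C" if "s @ t \<in> l1_family e C" for C s t
        using that by (rule l1_family_subset) simp
    qed (rule large)
  qed
  then obtain C r where r: "strict_mono r" "range r \<subseteq> M"
    "\<forall>H\<in>schreier \<phi> \<xi>. H \<noteq> {} \<longrightarrow> sorted_list_of_set (r ` H) \<in> l1_family e C"
    by (elim exE conjE)
  \<comment> \<open>Composing with \<open>Suc\<close> cancels the shift \<open>i - 1\<close>: for
    positive \<open>i\<close> the \<open>i\<close>-th vector is \<open>e (r i)\<close>.\<close>
  have "generates_l1_spreading_model \<phi> \<xi> (e \<circ> (r \<circ> Suc))"
    unfolding generates_l1_spreading_model_def
  proof (intro conjI allI exI ballI)
    show "norm ((e \<circ> (r \<circ> Suc)) n) = 1" for n using r(2) by (auto simp: M_def)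
    show "basic_sequence (e \<circ> (r \<circ> Suc))"
      by (rule basic_subsequence) (use r(1) in \<open>auto simp: strict_mono_def\<close>)
    show "1 \<le> max 1 (real C)" by simp
    fix H assume H: "H \<in> schreier \<phi> \<xi>"
    show "equiv_l1_basis (max 1 (real C)) (subseq_on (\<lambda>i. (e \<circ> (r \<circ> Suc)) (i - 1)) H)"
    proof (cases "H = {}")
      case False
      have fin: "finite H" using H by (rule schreier_finite)
      have "subseq_on (\<lambda>i. (e \<circ> (r \<circ> Suc)) (i - 1)) H = map e (sorted_list_of_set (r ` H))"
      proof -
        have "Suc (p - 1) = p" if "p \<in> H" for p using schreier_pos[OF H that] by simp
        thus ?thesis
          using fin by (simp add: subseq_on_def sorted_list_of_set_strict_mono_image[OF r(1)])
      qed
      moreover have "norm (e n) = 1" if "n \<in> r ` H" for n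
        using that r(2) by (auto simp: M_def)
      ultimately show ?thesis
        using equiv_l1_basis_if_l1_family[of "sorted_list_of_set (r ` H)" e C] r(3) H False fin
        by simp
    qed (simp add: subseq_on_def equiv_l1_basis_def)
  qed
  thus ?thesis using r(1) by (intro exI[of _ "r \<circ> Suc"]) (auto simp: strict_mono_def)
qed

end
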